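(* Let $n\ge2$, let $\delta>24n^42^n\log(n)$ and let $\mathbf{u}$ be a unit vector of $\mathbb{R}^n$. Put $q_0=n(n+1)\delta/2$. Then there exists a rigid $n$-system $\mathbf{R}\colon[q_0,\infty)\to\mathbb{R}^n$ of mesh $\delta$ such that $\|\mathbf{L}_\mathbf{u}(q)-\mathbf{R}(q)\|_\infty\le4n^2\delta$ for each $q\ge q_0$.
   Context: For a unit vector $\mathbf{u}$ and $q\ge0$, $\mathcal{C}_\mathbf{u}(e^q)=\{\mathbf{x}\in\mathbb{R}^n:\|\mathbf{x}\|\le1,|\mathbf{x}\cdot\mathbf{u}|\le e^{-q}\}$ (Euclidean norm), $L_{\mathbf{u},j}(q)$ is the smallest $L\ge0$ such that $e^L\mathcal{C}_\mathbf{u}(e^q)$ contains $j$ linearly independent points of $\mathbb{Z}^n$, and $\mathbf{L}_\mathbf{u}=(L_{\mathbf{u},1},\dots,L_{\mathbf{u},n})$. $\Delta_n=\{x\in\mathbb{R}^n:x_1\le\cdots\le x_n\}$; $\Phi_n$ sorts coordinates increasingly. A canvas with mesh $\delta$ and cardinality $s\in\{1,2,\dots\}\cup\{\infty\}$: points $\mathbf{a}^{(i)}\in\Delta_n$ and integers $k_i,\ell_i$ ($0\le i<s$) with (C1) $a^{(i)}_1<\cdots<a^{(i)}_n$ positive integer multiples of $\delta$; (C2) $1\le k_0\le\ell_0=n$, and $1\le k_i<\ell_i\le n$ for $i\ge1$; (C3) if $i+1<s$: $k_i\le\ell_{i+1}$, $a^{(i)}_{\ell_{i+1}}+\delta\le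 a^{(i+1)}_{\ell_{i+1}}$, and deleting coordinate $k_i$ of $\mathbf{a}^{(i)}$ gives the same tuple as deleting coordinate $\ell_{i+1}$ of $\mathbf{a}^{(i+1)}$. With $q_i=a^{(i)}_1+\cdots+a^{(i)}_n$ and $q_s=\infty$ if $s<\infty$, the attached rigid $n$-system with mesh $\delta$ is the map on $[q_0,\infty)$ given by $\mathbf{R}(q)=\Phi_n(a^{(i)}_1,\dots,\widehat{a^{(i)}_{k_i}},\dots,a^{(i)}_n,a^{(i)}_{k_i}+q-q_i)$ for $q_i\le q<q_{i+1}$ (hat = omission); here $q_0$ denotes the first switch number of the canvas. *)

theory Defs
  imports "HOL-Analysis.Analysis"
begin

definition convex_body :: "real ^ 'n \<Rightarrow> real \<Rightarrow> (real ^ 'n) set" where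
  "convex_body u Q = {x. norm x \<le> 1 \<and> \<bar>x \<bullet> u\<bar> \<le> 1 / Q}"

definition integer_points :: "(real ^ 'n) set" where
  "integer_points = {x. \<forall>i. x $ i \<in> \<int>}"

definition has_indep_points :: "real ^ 'n \<Rightarrow> nat \<Rightarrow> real \<Rightarrow> real \<Rightarrow> bool" where
  "has_indep_points u j q L \<longleftrightarrow>
     (\<exists>S. S \<subseteq> (\<lambda>x. exp L *\<^sub>R x) ` convex_body u (exp q) \<inter> integer_points
        \<and> finite S \<and> card S = j \<and> independent S)"

text \<open>
  Only meaningful for \<open>1 \<le> j \<le> CARD('n)\<close>; then, for a unit vector and \<open>q \<ge> 0\<close>, the
  minimum is attained (lemma \<open>log_minimum_attained\<close> below).
\<close>
definition log_minimum :: "real ^ 'n \<Rightarrow> nat \<Rightarrow> real \<Rightarrow> real" where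
  "log_minimum u j q = (LEAST L. 0 \<le> L \<and> has_indep_points u j q L)"

text \<open>
  Points of \<open>\<real>\<^sup>n\<close> whose coordinates are compared by size are lists of length \<open>n\<close>: the library
  function \<^const>\<open>sort\<close> is then the map that arranges the coordinates in increasing order.
\<close>
definition log_minima :: "real ^ 'n \<Rightarrow> real \<Rightarrow> real list" where
  "log_minima u q = map (\<lambda>j. log_minimum u j q) [1..<Suc CARD('n)]"

definition sup_norm :: "real list \<Rightarrow> real" where
  "sup_norm x = Max (abs ` set x)"

text \<open>Coordinates are numbered from 1.\<close>

definition coord :: "'a list \<Rightarrow> nat \<Rightarrow> 'a" where
  "coord x j = x ! (j - 1)"

definition delete_coord :: "nat \<Rightarrow> 'a list \<Rightarrow> 'a list" where
  "delete_coord j x = take (j - 1) x @ drop j x"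

definition canvas ::
  "nat \<Rightarrow> real \<Rightarrow> enat \<Rightarrow> (nat \<Rightarrow> real list) \<Rightarrow> (nat \<Rightarrow> nat) \<Rightarrow> (nat \<Rightarrow> nat) \<Rightarrow> bool" where
  "canvas n \<delta> s a k l \<longleftrightarrow>
     0 < \<delta> \<and> 1 \<le> s \<and>
     (\<forall>i. enat i < s \<longrightarrow> length (a i) = n \<and> sorted_wrt (<) (a i)
        \<and> (\<forall>x \<in> set (a i). \<exists>m::nat. 1 \<le> m \<and> x = real m * \<delta>)) \<and>
     1 \<le> k 0 \<and> k 0 \<le> l 0 \<and> l 0 = n \<and>
     (\<forall>i. 1 \<le> i \<and> enat i < s \<longrightarrow> 1 \<le> k i \<and> k i < l i \<and> l i \<le> n) \<and>
     (\<forall>i. enat (i + 1) < s \<longrightarrow> k i \<le> l (i + 1)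
        \<and> coord (a i) (l (i + 1)) + \<delta> \<le> coord (a (i + 1)) (l (i + 1))
        \<and> delete_coord (k i) (a i) = delete_coord (l (i + 1)) (a (i + 1)))"

abbreviation switch_number :: "(nat \<Rightarrow> real list) \<Rightarrow> nat \<Rightarrow> real" where
  "switch_number a i \<equiv> sum_list (a i)"

text \<open>
  \<open>R\<close> is a rigid \<open>n\<close>-system of mesh \<open>\<delta>\<close> on \<open>[q0, \<infinity>)\<close>. Its values to the left of \<open>q0\<close>, the
  first switch number of the canvas, are irrelevant. For the last index \<open>i\<close> of a finite canvas,
  the upper bound on \<open>q\<close> is void, since the next switch number is \<open>\<infinity>\<close>.
\<close>
definition rigid_system :: "nat \<Rightarrow> real \<Rightarrow> real \<Rightarrow> (real \<Rightarrow> real list) \<Rightarrow> bool" where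
  "rigid_system n \<delta> q0 R \<longleftrightarrow>
     (\<exists>s a k l. canvas n \<delta> s a k l \<and> q0 = switch_number a 0 \<and>
        (\<forall>i q. enat i < s \<longrightarrow> switch_number a i \<le> q
            \<longrightarrow> (enat (i + 1) < s \<longrightarrow> q < switch_number a (i + 1))
            \<longrightarrow> R q = sort (delete_coord (k i) (a i)
                            @ [coord (a i) (k i) + q - switch_number a i])))"

lemma mem_scaled_convex_body:
  "x \<in> (\<lambda>x. exp L *\<^sub>R x) ` convex_body u (exp q) \<longleftrightarrow>
     norm x \<le> exp L \<and> \<bar>x \<bullet> u\<bar> \<le> exp (L - q)"
proof -
  have inj: "x = exp L *\<^sub>R y \<longleftrightarrow> y = exp (- L) *\<^sub>R x" for y
    by (auto simp flip: exp_add)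
  have "x \<in> (\<lambda>x. exp L *\<^sub>R x) ` convex_body u (exp q) \<longleftrightarrow>
      exp (- L) *\<^sub>R x \<in> convex_body u (exp q)"
    unfolding image_iff inj by auto
  then show ?thesis
    by (simp add: convex_body_def exp_minus exp_diff abs_mult field_simps)
qed

lemma finite_integer_points_bounded:
  "finite {x \<in> integer_points :: (real ^ 'n) set. norm x \<le> B}"
proof (rule finite_subset)
  show "{x \<in> integer_points :: (real ^ 'n) set. norm x \<le> B} \<subseteq>
      (\<lambda>f. \<chi> i. of_int (f i)) ` (UNIV \<rightarrow>\<^sub>E {- \<lceil>B\<rceil>..\<lceil>B\<rceil>})"
  proof
    fix x :: "real ^ 'n"
    assume x: "x \<in> {x \<in> integer_points. norm x \<le> B}"
    have e: "of_int \<lfloor>x $ i\<rfloor> = x $ i" for i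
      using x by (auto simp: integer_points_def)
    have b: "\<bar>x $ i\<bar> \<le> of_int \<lceil>B\<rceil>" for i
      using x component_le_norm_cart[of x i] by (auto intro: order_trans le_of_int_ceiling)
    have c: "- \<lceil>B\<rceil> \<le> \<lfloor>x $ i\<rfloor> \<and> \<lfloor>x $ i\<rfloor> \<le> \<lceil>B\<rceil>" for i
      using b[of i] e[of i] by linarith
    show "x \<in> (\<lambda>f. \<chi> i. of_int (f i)) ` (UNIV \<rightarrow>\<^sub>E {- \<lceil>B\<rceil>..\<lceil>B\<rceil>})"
      by (rule image_eqI[of _ _ "\<lambda>i. \<lfloor>x $ i\<rfloor>"]) (use c in \<open>auto simp: vec_eq_iff e\<close>)
  qed
  show "finite ((\<lambda>f. \<chi> i. of_int (f i) :: real ^ 'n) ` (UNIV \<rightarrow>\<^sub>E {- \<lceil>B\<rceil>..\<lceil>B\<rceil>}))"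
    by (intro finite_imageI finite_PiE) auto
qed

lemma log_minimum_attained:
  fixes u :: "real ^ 'n"
  assumes u: "norm u = 1" and q: "0 \<le> q" and j: "1 \<le> j" "j \<le> CARD('n)"
  shows "0 \<le> log_minimum u j q" "has_indep_points u j q (log_minimum u j q)"
    and "\<And>L. 0 \<le> L \<Longrightarrow> has_indep_points u j q L \<Longrightarrow> log_minimum u j q \<le> L"
proof -
  define F where "F = {S \<in> Pow {x \<in> integer_points :: (real ^ 'n) set. norm x \<le> exp q}.
                        finite S \<and> card S = j \<and> independent S}"
  define K where "K = (\<Union>S\<in>F. {0..q} \<inter>
      (\<Inter>x\<in>S. {L. norm x \<le> exp L} \<inter> {L. \<bar>x \<bullet> u\<bar> \<le> exp (L - q)}))"
  have finF: "finite F"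
    unfolding F_def using finite_integer_points_bounded[of "exp q"]
    by (intro finite_subset[OF Collect_restrict]) simp
  have K_iff: "L \<in> K \<longleftrightarrow> 0 \<le> L \<and> L \<le> q \<and> has_indep_points u j q L" for L
  proof
    assume "L \<in> K"
    then show "0 \<le> L \<and> L \<le> q \<and> has_indep_points u j q L"
      unfolding K_def F_def has_indep_points_def
      by (fastforce simp: mem_scaled_convex_body)
  next
    assume L: "0 \<le> L \<and> L \<le> q \<and> has_indep_points u j q L"
    then obtain S where S: "S \<subseteq> (\<lambda>x. exp L *\<^sub>R x) ` convex_body u (exp q) \<inter> integer_points"
        "finite S" "card S = j" "independent S"
      unfolding has_indep_points_def by blast
    have m: "norm x \<le> exp L \<and> \<bar>x \<bullet> u\<bar> \<le> exp (L - q)" if "x \<in> S" for x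
      using S(1) that mem_scaled_convex_body[of x L u q] by blast
    moreover have "exp L \<le> exp q" using L by simp
    ultimately have "norm x \<le> exp q" if "x \<in> S" for x
      using that by (meson order_trans)
    then have "S \<in> F" using S by (auto simp: F_def)
    then show "L \<in> K" unfolding K_def using L m by auto
  qed
  have "compact K"
    unfolding K_def
    by (intro compact_UN finF compact_Int_closed compact_Icc closed_INT ballI closed_Int
        closed_Collect_le continuous_intros)
  moreover have "q \<in> K"
  proof -
    obtain B where B: "B \<subseteq> (Basis :: (real ^ 'n) set)" "card B = j"
      using j obtain_subset_with_card_n[of j "Basis :: (real ^ 'n) set"] by auto
    have "x \<in> integer_points \<and> norm x \<le> exp q \<and> \<bar>x \<bullet> u\<bar> \<le> 1" if "x \<in> B" for x
    proof -
      have x: "x \<in> Basis" using that B by blast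
      then obtain i where "x = axis i 1" by (auto simp: Basis_vec_def)
      then have "x \<in> integer_points" by (auto simp: integer_points_def axis_def)
      then show ?thesis using x q Cauchy_Schwarz_ineq2[of x u] u by simp
    qed
    then have "B \<subseteq> (\<lambda>x. exp q *\<^sub>R x) ` convex_body u (exp q) \<inter> integer_points"
      by (auto simp: mem_scaled_convex_body)
    moreover have "independent B" using B independent_Basis independent_mono by blast
    ultimately show ?thesis
      unfolding K_iff has_indep_points_def using B q finite_subset[OF B(1)] by auto
  qed
  ultimately obtain M where M: "M \<in> K" "\<And>L. L \<in> K \<Longrightarrow> M \<le> L"
    using compact_attains_inf[of K] by blast
  have least: "M \<le> L" if "0 \<le> L \<and> has_indep_points u j q L" for L
  proof (cases "L \<le> q")
    case True
    then show ?thesis using that M(2) K_iff by blast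
  next
    case False
    then show ?thesis using M(1) K_iff[of M] by linarith
  qed
  have "log_minimum u j q = M"
    unfolding log_minimum_def by (rule Least_equality) (use M(1) K_iff least in auto)
  then show "0 \<le> log_minimum u j q" "has_indep_points u j q (log_minimum u j q)"
    and "\<And>L. 0 \<le> L \<Longrightarrow> has_indep_points u j q L \<Longrightarrow> log_minimum u j q \<le> L"
    using M(1) K_iff[of M] least by auto
qed

lemma sum_list_delete_coord:
  fixes x :: "real list"
  assumes "1 \<le> j" "j \<le> length x"
  shows "sum_list x = sum_list (delete_coord j x) + coord x j"
proof -
  have "x = take (j - 1) x @ x ! (j - 1) # drop (Suc (j - 1)) x"
    using assms by (intro id_take_nth_drop) auto
  then have "sum_list x = sum_list (take (j - 1) x @ x ! (j - 1) # drop (Suc (j - 1)) x)"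
    by simp
  then show ?thesis using assms by (simp add: delete_coord_def coord_def)
qed

lemma canvas_index_bounds:
  assumes "canvas n \<delta> s a k l" "enat i < s"
  shows "1 \<le> k i \<and> k i \<le> l i \<and> l i \<le> n"
proof (cases "i = 0")
  case True
  then show ?thesis using assms by (simp add: canvas_def)
next
  case False
  then have "1 \<le> i" by simp
  then have "1 \<le> k i \<and> k i < l i \<and> l i \<le> n"
    using assms unfolding canvas_def by blast
  then show ?thesis by linarith
qed

lemma switch_number_step:
  assumes c: "canvas n \<delta> s a k l" and s: "enat (i + 1) < s"
  shows "switch_number a i + \<delta> \<le> switch_number a (i + 1)"
proof -
  have si: "enat i < s" using s by (metis enat_ord_simps(2) less_add_one order_less_trans)
  have len: "length (a i) = n" "length (a (i + 1)) = n" and srt: "sorted (a i)"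
    and C3: "k i \<le> l (i + 1)" "coord (a i) (l (i + 1)) + \<delta> \<le> coord (a (i + 1)) (l (i + 1))"
      "delete_coord (k i) (a i) = delete_coord (l (i + 1)) (a (i + 1))"
    using c s si strict_sorted_imp_sorted unfolding canvas_def by blast+
  have k: "1 \<le> k i" "k i \<le> n" and l: "1 \<le> l (i + 1)" "l (i + 1) \<le> n"
    using canvas_index_bounds[OF c si] canvas_index_bounds[OF c s] by auto
  have "coord (a i) (k i) \<le> coord (a i) (l (i + 1))"
    unfolding coord_def by (rule sorted_nth_mono[OF srt]) (use C3 l len in auto)
  then show ?thesis
    using sum_list_delete_coord[of "k i" "a i"]
      sum_list_delete_coord[of "l (i + 1)" "a (i + 1)"] C3 k l len by simp
qed

text \<open>
  The intervals between consecutive switch numbers cover \<open>[q0, \<infinity>)\<close>, so that the defining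
  condition determines \<open>R\<close> there.
\<close>
lemma switch_interval:
  assumes c: "canvas n \<delta> s a k l" and q: "switch_number a 0 \<le> q"
  shows "\<exists>i. enat i < s \<and> switch_number a i \<le> q
           \<and> (enat (i + 1) < s \<longrightarrow> q < switch_number a (i + 1))"
proof (rule ccontr)
  assume no: "\<not> ?thesis"
  have pos: "0 < \<delta>" and s0: "enat 0 < s"
    using c unfolding canvas_def by (auto simp: zero_enat_def[symmetric] intro: less_le_trans)
  have "enat i < s \<and> switch_number a 0 + real i * \<delta> \<le> switch_number a i
        \<and> switch_number a i \<le> q" for i
  proof (induction i)
    case 0
    then show ?case using q s0 by simp
  next
    case (Suc i)
    then have "enat (i + 1) < s" "switch_number a (i + 1) \<le> q" using no by force+
    then show ?case using switch_number_step[OF c, of i] Suc by (simp add: algebra_simps)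
  qed
  then have "real i * \<delta> \<le> q - switch_number a 0" for i
    by (smt (verit))
  then show False using reals_Archimedean3[OF pos] by (meson not_le)
qed

text \<open>
  Hence no coordinate is lost in the list \<open>map2 (-) (log_minima u q) (R q)\<close> of differences.
\<close>
lemma rigid_system_length:
  assumes "rigid_system n \<delta> q0 R" "q0 \<le> q"
  shows "length (R q) = n"
proof -
  obtain s a k l where c: "canvas n \<delta> s a k l" and q0: "q0 = switch_number a 0"
    and R: "\<And>i q. \<lbrakk>enat i < s; switch_number a i \<le> q;
          enat (i + 1) < s \<longrightarrow> q < switch_number a (i + 1)\<rbrakk>
        \<Longrightarrow> R q = sort (delete_coord (k i) (a i)
                      @ [coord (a i) (k i) + q - switch_number a i])"
    using assms(1) unfolding rigid_system_def by blast
  obtain i where i: "enat i < s" "switch_number a i \<le> q"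
      "enat (i + 1) < s \<longrightarrow> q < switch_number a (i + 1)"
    using switch_interval[OF c] assms(2) q0 by blast
  have "length (a i) = n" using c i(1) unfolding canvas_def by blast
  then show ?thesis
    using R[OF i] canvas_index_bounds[OF c i(1)] by (auto simp: delete_coord_def min_def)
qed

end

theory Submission
  imports Defs
begin

text \<open>
  While the gap \<open>L\<^sub>j\<^sub>+\<^sub>1 - L\<^sub>j\<close> stays larger than a constant, the integer points realizing the first
  \<open>j\<close> minima span a fixed subspace \<open>V\<close> (\<open>minimal_space\<close>). As long as \<open>V\<close> is nearly orthogonal to
  \<open>u\<close> at the scale \<open>exp (- q)\<close>, the minima \<open>L\<^sub>1, \<dots>, L\<^sub>j\<close> do not move; from the moment it is not
  (\<open>steep\<close>), a suitable vector of \<open>V\<close> can be added to any integer point to cancel its product with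
  \<open>u\<close>, so that \<open>L\<^sub>j\<^sub>+\<^sub>1, \<dots>, L\<^sub>n\<close> do not move. Larger subspaces become steep earlier. So at each time
  there is one cluster of nearly equal minima that grows, while all others are static, and the
  growth passes from below a rank to above it only when the gap at that rank closes.

  The rigid system is built greedily: whenever a minimum of the growing cluster has caught up with
  its grid point, a grid particle is moved to the first vacant place above. The preceding
  property is exactly what allows the particle that moved last to be continued if the next one to be
  moved lies above. This controls the error at each coordinate with no accumulation. Minkowski's
  second theorem (with a weak constant) then compares the parameter of the system, which is the
  sum of its coordinates, with \<open>q\<close>.
\<close>

section \<open>Minima and the subspaces that realize them\<close>

text \<open>The gauge of the body: \<open>convex_body u (exp q)\<close> is the set where it is at
  most 1. In its terms L_j is the logarithm of the j-th successive minimum.\<close>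

definition body_norm :: "real ^ 'n \<Rightarrow> real \<Rightarrow> real ^ 'n \<Rightarrow> real" where
  "body_norm u q x = max (norm x) (exp q * \<bar>x \<bullet> u\<bar>)"

definition short_points :: "real ^ 'n \<Rightarrow> real \<Rightarrow> real \<Rightarrow> (real ^ 'n) set" where
  "short_points u q r = {x \<in> integer_points. body_norm u q x \<le> r}"

lemma body_norm_nonneg: "0 \<le> body_norm u q x"
  by (simp add: body_norm_def le_max_iff_disj)

lemma body_norm_triangle: "body_norm u q (x + y) \<le> body_norm u q x + body_norm u q y"
proof -
  have "norm (x + y) \<le> body_norm u q x + body_norm u q y"
    unfolding body_norm_def by (intro norm_triangle_le add_mono) auto
  moreover have "exp q * \<bar>(x + y) \<bullet> u\<bar> \<le> exp q * \<bar>x \<bullet> u\<bar> + exp q * \<bar>y \<bullet> u\<bar>"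
    by (simp add: inner_add_left flip: distrib_left)
  then have "exp q * \<bar>(x + y) \<bullet> u\<bar> \<le> body_norm u q x + body_norm u q y"
    unfolding body_norm_def by linarith
  ultimately show ?thesis by (simp add: body_norm_def)
qed

lemma body_norm_scale: "body_norm u q (c *\<^sub>R x) = \<bar>c\<bar> * body_norm u q x"
  by (simp add: body_norm_def abs_mult max_mult_distrib_left mult.left_commute)

lemma body_norm_sum: "body_norm u q (sum f S) \<le> (\<Sum>x\<in>S. body_norm u q (f x))"
proof (induction S rule: infinite_finite_induct)
  case (insert x S)
  then show ?case using body_norm_triangle[of u q "f x" "sum f S"] by simp
qed (auto simp: body_norm_def)

lemma body_norm_mono: "q \<le> q' \<Longrightarrow> body_norm u q x \<le> body_norm u q' x"
  unfolding body_norm_def by (intro max.mono mult_right_mono) auto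

lemma body_norm_growth:
  assumes "q \<le> q'" shows "body_norm u q' x \<le> exp (q' - q) * body_norm u q x"
proof -
  have "norm x \<le> exp (q' - q) * body_norm u q x"
    using assms mult_mono[of 1 "exp (q' - q)" "norm x" "body_norm u q x"] by (simp add: body_norm_def)
  moreover have "exp q' * \<bar>x \<bullet> u\<bar> = exp (q' - q) * (exp q * \<bar>x \<bullet> u\<bar>)"
    by (simp add: exp_diff)
  then have "exp q' * \<bar>x \<bullet> u\<bar> \<le> exp (q' - q) * body_norm u q x"
    unfolding body_norm_def by (metis exp_ge_zero max.cobounded2 mult_left_mono)
  ultimately show ?thesis by (simp add: body_norm_def)
qed

lemma short_points_eq:
  "short_points u q (exp L) = (\<lambda>x. exp L *\<^sub>R x) ` convex_body u (exp q) \<inter> integer_points"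
proof -
  have "x \<in> short_points u q (exp L) \<longleftrightarrow>
      x \<in> (\<lambda>x. exp L *\<^sub>R x) ` convex_body u (exp q) \<inter> integer_points" for x
    unfolding Int_iff mem_scaled_convex_body
    by (simp add: short_points_def body_norm_def exp_diff field_simps conj_commute)
  then show ?thesis by blast
qed

text \<open>Replaces sets of independent points by a dimension, so that minima can be compared
  through spans.\<close>

lemma has_indep_points_iff: "has_indep_points u j q L \<longleftrightarrow> j \<le> dim (short_points u q (exp L))"
proof
  assume "has_indep_points u j q L"
  then show "j \<le> dim (short_points u q (exp L))"
    unfolding has_indep_points_def short_points_eq using independent_card_le_dim by blast
next
  assume j: "j \<le> dim (short_points u q (exp L))"
  obtain B where B: "B \<subseteq> short_points u q (exp L)" "independent B"
    "card B = dim (short_points u q (exp L))"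
    by (rule basis_exists)
  then obtain S where "S \<subseteq> B" "card S = j" "finite S"
    using obtain_subset_with_card_n[of j B] j by metis
  then show "has_indep_points u j q L"
    unfolding has_indep_points_def short_points_eq[symmetric]
    using B independent_mono[of B S] by (intro exI[of _ S]) auto
qed

lemma one_le_norm_integer_points:
  assumes "x \<in> integer_points" "x \<noteq> 0" shows "1 \<le> norm (x :: real ^ 'n)"
proof -
  obtain i where "x $ i \<noteq> 0" using assms by (auto simp: vec_eq_iff)
  moreover have "x $ i \<in> \<int>" using assms by (auto simp: integer_points_def)
  ultimately have "1 \<le> \<bar>x $ i\<bar>" by (rule Ints_nonzero_abs_ge1[rotated])
  then show ?thesis using component_le_norm_cart[of x i] by linarith
qed

lemma short_points_mono: "r \<le> r' \<Longrightarrow> short_points u q r \<subseteq> short_points u q r'"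
  by (auto simp: short_points_def)

text \<open>A nonzero integer point has Euclidean norm at least 1, so j \<ge> 1 independent points
  already force \<open>1 \<le> exp L\<close>. The constraint \<open>0 \<le> L\<close> is thus
  automatic and the equivalence holds for every real \<open>L\<close>.\<close>

lemma log_minimum_le_iff:
  fixes u :: "real ^ 'n"
  assumes "norm u = 1" "0 \<le> q" "1 \<le> j" "j \<le> CARD('n)"
  shows "log_minimum u j q \<le> L \<longleftrightarrow> j \<le> dim (short_points u q (exp L))"
proof
  assume "log_minimum u j q \<le> L"
  then have "short_points u q (exp (log_minimum u j q)) \<subseteq> short_points u q (exp L)"
    by (intro short_points_mono) simp
  then show "j \<le> dim (short_points u q (exp L))"
    using log_minimum_attained(2)[OF assms] dim_subset
    unfolding has_indep_points_iff by (meson order_trans)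
next
  assume j: "j \<le> dim (short_points u q (exp L))"
  then have "\<not> short_points u q (exp L) \<subseteq> {0}" using assms(3) by (metis dim_eq_0 not_one_le_zero le_trans)
  then obtain x where "x \<in> integer_points" "x \<noteq> 0" "body_norm u q x \<le> exp L"
    by (auto simp: short_points_def)
  then have "1 \<le> exp L" using one_le_norm_integer_points[of x]
    by (auto simp: body_norm_def simp del: one_le_exp_iff)
  then show "log_minimum u j q \<le> L"
    using log_minimum_attained(3)[OF assms] j by (simp add: has_indep_points_iff)
qed

text \<open>Its dimension is at least j; for 1 \<le> j < n it equals j exactly when L_j < L_{j+1}.
  Only then is it the span of any j independent points realizing the first j minima.\<close>

definition minimal_space :: "real ^ 'n \<Rightarrow> nat \<Rightarrow> real \<Rightarrow> (real ^ 'n) set" where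
  "minimal_space u j q = span (short_points u q (exp (log_minimum u j q)))"

text \<open>Equivalently, the orthogonal projection of \<open>u\<close> on the space has norm at least \<open>exp (- q)\<close>.\<close>
definition steep :: "real ^ 'n \<Rightarrow> nat \<Rightarrow> real \<Rightarrow> bool" where
  "steep u j q \<longleftrightarrow> (\<exists>p \<in> minimal_space u j q. p \<noteq> 0 \<and> norm p \<le> exp q * \<bar>p \<bullet> u\<bar>)"

lemma integer_points_add: "x \<in> integer_points \<Longrightarrow> y \<in> integer_points \<Longrightarrow> x + y \<in> integer_points"
  by (simp add: integer_points_def)

lemma integer_points_sum_of_int:
  "(\<And>x. x \<in> S \<Longrightarrow> f x \<in> integer_points) \<Longrightarrow> (\<Sum>x\<in>S. of_int (c x) *\<^sub>R f x) \<in> integer_points"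
  unfolding integer_points_def by (auto simp: sum_component intro!: Ints_sum Ints_mult)

lemma steep_mono:
  assumes "q \<le> q'" "minimal_space u j q = minimal_space u j q'" "steep u j q"
  shows "steep u j q'"
proof -
  obtain p where p: "p \<in> minimal_space u j q'" "p \<noteq> 0" "norm p \<le> exp q * \<bar>p \<bullet> u\<bar>"
    using assms unfolding steep_def by auto
  moreover have "exp q * \<bar>p \<bullet> u\<bar> \<le> exp q' * \<bar>p \<bullet> u\<bar>" using assms(1) by (simp add: mult_right_mono)
  ultimately show ?thesis unfolding steep_def by (meson order_trans)
qed

section \<open>Dependence of the minima on the parameter\<close>

context
  fixes u :: "real ^ 'n"
  assumes u: "norm u = 1"
begin

text \<open>The common source of the upper bounds below: the points realizing L_j at
  \<open>q\<close> need not be short at \<open>q'\<close>, only lie in the span of points that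
  are.\<close>

lemma log_minimum_le_transfer:
  assumes "0 \<le> q" "0 \<le> q'" "1 \<le> j" "j \<le> CARD('n)"
    and "short_points u q (exp (log_minimum u j q)) \<subseteq> span (short_points u q' (exp L))"
  shows "log_minimum u j q' \<le> L"
proof -
  have "j \<le> dim (short_points u q (exp (log_minimum u j q)))"
    using assms log_minimum_le_iff[OF u, of q j "log_minimum u j q"] by simp
  also have "\<dots> \<le> dim (short_points u q' (exp L))"
    using assms(5) by (metis dim_subset dim_span)
  finally show ?thesis using assms by (simp add: log_minimum_le_iff[OF u])
qed

lemma log_minimum_mono_index:
  assumes "0 \<le> q" "1 \<le> i" "i \<le> j" "j \<le> CARD('n)"
  shows "log_minimum u i q \<le> log_minimum u j q"
  using assms log_minimum_le_iff[OF u, of q j "log_minimum u j q"]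
  by (subst log_minimum_le_iff[OF u]) auto

lemma log_minimum_mono:
  assumes "0 \<le> q" "q \<le> q'" "1 \<le> j" "j \<le> CARD('n)"
  shows "log_minimum u j q \<le> log_minimum u j q'"
proof -
  have "short_points u q' r \<subseteq> short_points u q r" for r
    using body_norm_mono[OF assms(2)] by (auto simp: short_points_def intro: order_trans)
  then show ?thesis
    using assms log_minimum_le_transfer[of q' q j "log_minimum u j q'"] span_superset by fastforce
qed

lemma log_minimum_lipschitz:
  assumes "0 \<le> q" "q \<le> q'" "1 \<le> j" "j \<le> CARD('n)"
  shows "log_minimum u j q' \<le> log_minimum u j q + (q' - q)"
proof -
  have "short_points u q (exp r) \<subseteq> short_points u q' (exp (r + (q' - q)))" for r
  proof
    fix x assume x: "x \<in> short_points u q (exp r)"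
    have "body_norm u q' x \<le> exp (q' - q) * body_norm u q x" using body_norm_growth[OF assms(2)] .
    also have "\<dots> \<le> exp (q' - q) * exp r" using x by (simp add: short_points_def)
    finally show "x \<in> short_points u q' (exp (r + (q' - q)))"
      using x by (simp add: short_points_def mult.commute flip: exp_add)
  qed
  then show ?thesis
    using assms log_minimum_le_transfer[of q q' j] span_superset by fastforce
qed

lemma dim_minimal_space:
  assumes "0 \<le> q" "1 \<le> j" "j < CARD('n)" "log_minimum u j q < log_minimum u (Suc j) q"
  shows "dim (minimal_space u j q) = j"
  using assms log_minimum_le_iff[OF u, of q j "log_minimum u j q"]
    log_minimum_le_iff[OF u, of q "Suc j" "log_minimum u j q"]
  by (simp add: minimal_space_def dim_span)

text \<open>At time \<open>q'\<close> the integer points of gauge at most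
  \<open>exp (log_minimum u j q' + (q' - q))\<close> still span only dimension j, by
  \<open>gap'\<close>. This span contains the space at \<open>q'\<close>, and also the one at
  \<open>q\<close>, since gauges grow at most by \<open>exp (q' - q)\<close>. All three have
  dimension j.\<close>

lemma minimal_space_eq:
  assumes q: "0 \<le> q" "q \<le> q'" and j: "1 \<le> j" "j < CARD('n)"
    and gap: "log_minimum u j q < log_minimum u (Suc j) q"
    and gap': "log_minimum u j q' + (q' - q) < log_minimum u (Suc j) q'"
  shows "minimal_space u j q = minimal_space u j q'"
proof -
  let ?S = "short_points u q' (exp (log_minimum u j q' + (q' - q)))"
  have d: "dim (minimal_space u j q) = j" "dim (minimal_space u j q') = j"
    using dim_minimal_space[of q j] dim_minimal_space[of q' j] q j gap gap' by auto
  have "dim ?S < Suc j"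
    using gap' log_minimum_le_iff[OF u, of q' "Suc j" "log_minimum u j q' + (q' - q)"] q j by auto
  moreover have "short_points u q' (exp (log_minimum u j q')) \<subseteq> ?S"
    by (intro short_points_mono) (use q in auto)
  then have sub': "minimal_space u j q' \<subseteq> span ?S" unfolding minimal_space_def by (rule span_mono)
  ultimately have "minimal_space u j q' = span ?S"
    using d by (intro subspace_dim_equal) (auto simp: minimal_space_def dim_span)
  moreover have "short_points u q (exp (log_minimum u j q)) \<subseteq> ?S"
  proof
    fix x assume x: "x \<in> short_points u q (exp (log_minimum u j q))"
    have "body_norm u q' x \<le> exp (q' - q) * body_norm u q x" using body_norm_growth[OF q(2)] .
    also have "\<dots> \<le> exp (q' - q) * exp (log_minimum u j q)" using x by (simp add: short_points_def)
    also have "\<dots> \<le> exp (q' - q) * exp (log_minimum u j q')"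
      using log_minimum_mono[OF q, of j] j by simp
    finally show "x \<in> ?S"
      using x by (simp add: short_points_def add.commute flip: exp_add)
  qed
  then have "minimal_space u j q \<subseteq> span ?S" unfolding minimal_space_def by (rule span_mono)
  ultimately show ?thesis
    using d by (intro subspace_dim_equal) (auto simp: minimal_space_def)
qed

lemma minimal_space_mono:
  assumes "0 \<le> q" "1 \<le> i" "i \<le> j" "j \<le> CARD('n)"
  shows "minimal_space u i q \<subseteq> minimal_space u j q"
  unfolding minimal_space_def
  by (intro span_mono short_points_mono) (use log_minimum_mono_index[OF assms] in simp)

lemma steep_mono_index:
  assumes "0 \<le> q" "1 \<le> i" "i \<le> j" "j \<le> CARD('n)" "steep u i q"
  shows "steep u j q"
  using assms minimal_space_mono[of q i j] unfolding steep_def by blast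

text \<open>On a space that is not steep at \<open>q'\<close> the gauge reduces to the Euclidean
  norm, which does not depend on time. So the points realizing L_i at \<open>q\<close> have not
  become longer at \<open>q'\<close>.\<close>

lemma log_minimum_static:
  assumes q: "0 \<le> q" "q \<le> q'" and j: "1 \<le> i" "i \<le> j" "j < CARD('n)"
    and V: "minimal_space u j q = minimal_space u j q'" and ns: "\<not> steep u j q'"
  shows "log_minimum u i q' \<le> log_minimum u i q"
proof -
  have "short_points u q (exp (log_minimum u i q)) \<subseteq> short_points u q' (exp (log_minimum u i q))"
  proof
    fix x assume x: "x \<in> short_points u q (exp (log_minimum u i q))"
    then have "x \<in> minimal_space u i q" by (simp add: minimal_space_def span_base)
    then have "x \<in> minimal_space u j q'"
      using V minimal_space_mono[of q i j] q j by auto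
    then have "x = 0 \<or> \<not> norm x \<le> exp q' * \<bar>x \<bullet> u\<bar>" using ns unfolding steep_def by blast
    then have "body_norm u q' x \<le> body_norm u q x" unfolding body_norm_def by auto
    then show "x \<in> short_points u q' (exp (log_minimum u i q))"
      using x by (auto simp: short_points_def)
  qed
  then show ?thesis
    using assms log_minimum_le_transfer[of q q' i] span_superset by fastforce
qed

text \<open>Take \<open>x\<close> short at \<open>q\<close>. Steepness provides a real vector
  \<open>w\<close> of V with (x + w) . u = 0 and norm at most \<open>?r\<close>, so the gauge of
  \<open>x + w\<close> is at most \<open>2 * ?r\<close> at every time. Rounding \<open>w\<close> to
  an integer combination of short points of V keeps the result short at \<open>q'\<close>, and
  \<open>x\<close> lies in the span of that result and V.\<close>

lemma log_minimum_static_above: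
  assumes q: "0 \<le> q" "q \<le> q'" and j: "1 \<le> j" "j < i" "i \<le> CARD('n)"
    and V: "minimal_space u j q = minimal_space u j q'" and st: "steep u j q"
    and gap: "log_minimum u j q' + ln (real CARD('n)) \<le> log_minimum u (Suc j) q'"
    and gap0: "log_minimum u j q' < log_minimum u (Suc j) q'"
  shows "log_minimum u i q' \<le> log_minimum u i q + ln 4"
proof (rule ccontr)
  assume neg: "\<not> ?thesis"
  let ?l = "exp (log_minimum u j q')" and ?L = "exp (log_minimum u i q')"
    and ?r = "exp (log_minimum u i q)"
  have "exp (log_minimum u i q + ln 4) < ?L" using neg by simp
  then have Lr: "4 * ?r < ?L" by (simp add: exp_add)
  have le: "log_minimum u (Suc j) q' \<le> log_minimum u i q'"
    using log_minimum_mono_index[of q' "Suc j" i] q j by auto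
  have "exp (log_minimum u j q' + ln (real CARD('n))) \<le> ?L" using gap le by auto
  then have Ll: "real CARD('n) * ?l \<le> ?L" by (simp add: exp_add mult.commute)
  obtain X where X: "X \<subseteq> short_points u q' ?l" "independent X"
      "span X = minimal_space u j q'" "card X = j" "finite X"
  proof -
    obtain B where B: "B \<subseteq> short_points u q' ?l" "independent B" "short_points u q' ?l \<subseteq> span B"
      "card B = dim (short_points u q' ?l)"
      by (rule basis_exists)
    then have "span B = minimal_space u j q'"
      unfolding minimal_space_def by (metis span_eq span_superset order_trans)
    moreover have "card B = j"
      using B dim_minimal_space[of q' j] q j gap0 by (simp add: minimal_space_def dim_span)
    ultimately show ?thesis using B that finiteI_independent by blast
  qed
  \<comment> \<open>Bounds the gauges of the basis \<open>X\<close> and of the corrected points. It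
    stays below \<open>?L\<close>: the two summands are at most half of \<open>?L\<close>, the first
    strictly, by the factor 4 in \<open>Lr\<close> and the factor n in \<open>Ll\<close>.\<close>
  define s where "s = max ?l (2 * ?r + real j / 2 * ?l)"
  have jn: "real j * ?l \<le> ?L"
    using Ll j by (intro order_trans[OF mult_right_mono Ll]) auto

  have sL: "s < ?L"
    unfolding s_def using Lr jn le gap0 by auto
  have spos: "0 < s" unfolding s_def by (simp add: less_max_iff_disj)
  obtain p where p: "p \<in> minimal_space u j q'" "p \<noteq> 0" "norm p \<le> exp q * \<bar>p \<bullet> u\<bar>"
    using st V unfolding steep_def by auto
  then have pu: "\<bar>p \<bullet> u\<bar> > 0"
    by (metis abs_eq_0 abs_ge_zero mult_zero_right norm_le_zero_iff order_le_less)
  have Xs: "span X \<subseteq> span (short_points u q' s)"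
    using X(1) short_points_mono[of ?l s u q'] by (intro span_mono) (auto simp: s_def)
  have "short_points u q ?r \<subseteq> span (short_points u q' s)"
  proof
    fix x assume x: "x \<in> short_points u q ?r"
    \<comment> \<open>The multiple of \<open>p\<close> that cancels the product of \<open>x\<close>
      with \<open>u\<close>.\<close>
    define w where "w = (- (x \<bullet> u) / (p \<bullet> u)) *\<^sub>R p"
    have xr: "norm x \<le> ?r" "exp q * \<bar>x \<bullet> u\<bar> \<le> ?r" using x by (auto simp: short_points_def body_norm_def)
    have wu: "(x + w) \<bullet> u = 0" using pu by (simp add: w_def inner_add_left inner_diff_left)
    have "norm w = \<bar>x \<bullet> u\<bar> * (norm p / \<bar>p \<bullet> u\<bar>)" by (simp add: w_def)
    also have "\<dots> \<le> \<bar>x \<bullet> u\<bar> * exp q"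
      using p(3) pu by (intro mult_left_mono) (auto simp: field_simps)
    finally have "norm w \<le> ?r" using xr by (simp add: mult.commute)
    then have g1: "body_norm u q' (x + w) \<le> 2 * ?r"
      using wu xr norm_triangle_ineq[of x w] by (simp add: body_norm_def)
    have "w \<in> span X"
      unfolding w_def X(3) using p(1) unfolding minimal_space_def by (rule span_scale)
    then obtain c where c: "w = (\<Sum>v\<in>X. c v *\<^sub>R v)" using X(5) by (auto simp: span_finite)
    \<comment> \<open>Rounding each of the j coefficients costs at most half of the gauge of a basis
      vector.\<close>
    define v where "v = (\<Sum>v\<in>X. of_int (round (c v)) *\<^sub>R v)"
    have "v - w = (\<Sum>v\<in>X. (of_int (round (c v)) - c v) *\<^sub>R v)"
      by (simp add: v_def c sum_subtractf scaleR_diff_left)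
    also have "body_norm u q' \<dots> \<le> (\<Sum>v\<in>X. body_norm u q' ((of_int (round (c v)) - c v) *\<^sub>R v))"
      by (rule body_norm_sum)
    also have "\<dots> \<le> (\<Sum>v\<in>X. 1/2 * ?l)"
    proof (rule sum_mono)
      fix v assume "v \<in> X"
      then have "body_norm u q' v \<le> ?l" using X(1) by (auto simp: short_points_def)
      then show "body_norm u q' ((of_int (round (c v)) - c v) *\<^sub>R v) \<le> 1/2 * ?l"
        unfolding body_norm_scale using of_int_round_abs_le[of "c v"]
        by (intro mult_mono) (auto simp: body_norm_nonneg)
    qed
    also have "\<dots> = real j / 2 * ?l" using X(4) by simp
    finally have "body_norm u q' (x + w + (v - w)) \<le> s"
      using body_norm_triangle[of u q' "x + w" "v - w"] g1 unfolding s_def by linarith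
    moreover have "v \<in> integer_points" unfolding v_def
      using X(1) by (intro integer_points_sum_of_int) (auto simp: short_points_def)
    ultimately have "x + v \<in> short_points u q' s"
      using x integer_points_add by (auto simp: short_points_def)
    moreover have "v \<in> span X" unfolding v_def by (intro span_sum span_scale span_base)
    ultimately have "(x + v) - v \<in> span (short_points u q' s)"
      using Xs by (intro span_diff) (auto intro: span_base)
    then show "x \<in> span (short_points u q' s)" by simp
  qed
  then have "log_minimum u i q' \<le> ln s"
    using q j spos by (intro log_minimum_le_transfer[of q q']) auto
  moreover have "ln s < log_minimum u i q'" using sL spos by (metis exp_gt_zero ln_exp ln_less_cancel_iff)
  ultimately show False by simp
qed

end

section \<open>The sum of the minima\<close>

lemma lebesgue_unit_cube:
  "measure lebesgue (cbox 0 1 :: (real ^ 'n) set) = 1"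
  "measure lebesgue (box 0 1 :: (real ^ 'n) set) = 1"
proof -
  have *: "(\<Prod>b\<in>Basis. (1 :: real ^ 'n) \<bullet> b) = 1"
    by (intro prod.neutral) (auto simp: Basis_vec_def inner_axis)
  have "\<forall>b\<in>Basis. 0 \<le> (1 :: real ^ 'n) \<bullet> b" by (auto simp: Basis_vec_def inner_axis)
  then show "measure lebesgue (cbox 0 1 :: (real ^ 'n) set) = 1"
    "measure lebesgue (box 0 1 :: (real ^ 'n) set) = 1"
    using * by (auto simp: measure_completion measure_lborel_cbox_eq measure_lborel_box_eq)
qed

text \<open>Cut \<open>S\<close> along the unit cubes with integer corners and translate all pieces
  into one cube. The translates stay disjoint, since two points falling together would differ by an
  integer point.\<close>

lemma blichfeldt:
  fixes S :: "(real ^ 'n) set"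
  assumes S: "open S" "bounded S"
    and disj: "\<And>x y. x \<in> S \<Longrightarrow> y \<in> S \<Longrightarrow> x - y \<in> integer_points \<Longrightarrow> x = y"
  shows "measure lebesgue S \<le> 1"
proof -
  define fl :: "real ^ 'n \<Rightarrow> real ^ 'n" where "fl x = (\<chi> i. of_int \<lfloor>x $ i\<rfloor>)" for x
  \<comment> \<open>A half-open cube, written as a closed set cut with an open one so that it is
    visibly Borel.\<close>
  define C where "C z = {x. \<forall>i. z $ i \<le> x $ i} \<inter> {x. \<forall>i. x $ i < z $ i + 1}" for z :: "real ^ 'n"
  define I where "I = fl ` S"
  define piece where "piece z = S \<inter> C z" for z
  have fl_C: "x \<in> C (fl x)" for x by (simp add: C_def fl_def)
  have C_fl: "fl x = z" if "x \<in> C z" "z \<in> integer_points" for x z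
  proof -
    have "of_int \<lfloor>x $ i\<rfloor> = z $ i" for i
    proof -
      have "z $ i \<in> \<int>" using that by (simp add: integer_points_def)
      then obtain m where "z $ i = of_int m" by (auto elim: Ints_cases)
      moreover have "z $ i \<le> x $ i" "x $ i < z $ i + 1" using that by (auto simp: C_def)
      ultimately show ?thesis by (metis floor_unique)
    qed
    then show ?thesis by (simp add: fl_def vec_eq_iff)
  qed
  have int: "I \<subseteq> integer_points" by (auto simp: I_def fl_def integer_points_def)
  obtain B where B: "\<And>x. x \<in> S \<Longrightarrow> norm x \<le> B" using S(2) by (auto simp: bounded_iff)
  have "finite I"
  proof (rule finite_subset[OF _ finite_integer_points_bounded[of "B + real CARD('n)"]])
    have "norm (fl x) \<le> B + real CARD('n)" if "x \<in> S" for x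
    proof -
      have "norm (x - fl x) \<le> (\<Sum>i\<in>UNIV. \<bar>(x - fl x) $ i\<bar>)" by (rule norm_le_l1_cart)
      also have "\<dots> \<le> (\<Sum>i\<in>(UNIV::'n set). 1)"
      proof (intro sum_mono)
        fix i show "\<bar>(x - fl x) $ i\<bar> \<le> 1" unfolding fl_def by simp linarith
      qed
      finally have "norm (x - fl x) \<le> real CARD('n)" by simp
      then show ?thesis using B[OF that] norm_triangle_ineq4[of x "x - fl x"] by simp
    qed
    then show "I \<subseteq> {x \<in> integer_points. norm x \<le> B + real CARD('n)}" using int by (auto simp: I_def)
  qed
  have "closed {x :: real ^ 'n. \<forall>i. z $ i \<le> x $ i}" for z :: "real ^ 'n"
    by (intro closed_Collect_all closed_Collect_le continuous_intros)
  moreover have "open {x :: real ^ 'n. \<forall>i. x $ i < z $ i + 1}" for z :: "real ^ 'n"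
    unfolding Collect_all_eq
    by (intro open_INT ballI finite open_Collect_less continuous_intros)
  ultimately have "C z \<in> sets borel" for z unfolding C_def
    by (intro sets.Int) auto
  then have meas: "piece z \<in> lmeasurable" for z
    unfolding piece_def using S
    by (intro bounded_set_imp_lmeasurable sets.Int) (auto intro: sets_completionI_sets simp: bounded_Int)
  have S_eq: "S = \<Union> (piece ` I)" using fl_C by (auto simp: piece_def I_def)
  have pw: "pairwise (\<lambda>x y. negligible (piece x \<inter> piece y)) I"
  proof (intro pairwiseI)
    fix z z' assume "z \<in> I" "z' \<in> I" "z \<noteq> z'"
    then have "piece z \<inter> piece z' = {}" using C_fl[of _ z] C_fl[of _ z'] int by (auto simp: piece_def)
    then show "negligible (piece z \<inter> piece z')" by simp
  qed
  have tr: "(+) (- z) ` piece z \<in> lmeasurable" for z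
    using meas by (rule measurable_translation)
  have pw': "pairwise (\<lambda>x y. negligible ((+) (- x) ` piece x \<inter> (+) (- y) ` piece y)) I"
  proof (intro pairwiseI)
    fix z z' assume z: "z \<in> I" "z' \<in> I" "z \<noteq> z'"
    have "(+) (- z) ` piece z \<inter> (+) (- z') ` piece z' = {}"
    proof (rule ccontr)
      assume "\<not> ?thesis"
      then obtain x y where xy: "x \<in> piece z" "y \<in> piece z'" "x - z = y - z'" by auto
      then have "x - y = z - z'" by (simp add: algebra_simps)
      moreover have "z - z' \<in> integer_points" using z int by (auto simp: integer_points_def subset_iff)
      ultimately have "x = y" using disj xy by (auto simp: piece_def)
      then show False using xy z by simp
    qed
    then show "negligible ((+) (- z) ` piece z \<inter> (+) (- z') ` piece z')" by simp
  qed
  have "measure lebesgue S = (\<Sum>z\<in>I. measure lebesgue (piece z))"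
    unfolding S_eq by (rule measure_negligible_finite_Union_image[OF \<open>finite I\<close> meas pw])
  also have "\<dots> = (\<Sum>z\<in>I. measure lebesgue ((+) (- z) ` piece z))"
    by (simp only: measure_translation)
  also have "\<dots> = measure lebesgue (\<Union>z\<in>I. (+) (- z) ` piece z)"
    by (rule measure_negligible_finite_Union_image[symmetric, OF \<open>finite I\<close> tr pw'])
  also have "\<dots> \<le> measure lebesgue (cbox 0 1 :: (real ^ 'n) set)"
  proof (rule measure_mono_fmeasurable)
    show "(\<Union>z\<in>I. (+) (- z) ` piece z) \<subseteq> cbox 0 1"
      by (auto simp: piece_def C_def mem_box_cart less_imp_le algebra_simps)
    show "(\<Union>z\<in>I. (+) (- z) ` piece z) \<in> sets lebesgue"
      using tr \<open>finite I\<close> by (intro sets.finite_UN) auto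
  qed auto
  also have "\<dots> = 1" by (rule lebesgue_unit_cube)
  finally show ?thesis .
qed

text \<open>Differences of two points of the open parallelepiped \<open>B (0,1)^n\<close> have the
  form \<open>B d\<close> with all |d_i| < 1, so Blichfeldt's principle applies to it; its volume is
  |det B|.\<close>

lemma det_le_1_of_admissible:
  fixes B :: "real ^ ('n :: {finite, wellorder}) ^ ('n :: _)"
  assumes nz: "det B \<noteq> 0"
    and adm: "\<And>d. (\<And>i. \<bar>d $ i\<bar> < 1) \<Longrightarrow> B *v d \<in> integer_points \<Longrightarrow> B *v d = 0"
  shows "\<bar>det B\<bar> \<le> 1"
proof -
  let ?S = "(*v) B ` box 0 1"
  have lin: "linear ((*v) B)" by (rule matrix_vector_mul_linear)
  have "measure lebesgue ?S \<le> 1"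
  proof (rule blichfeldt)
    have "inj ((*v) B)" using nz by (simp add: invertible_det_nz inj_matrix_vector_mult)
    then show "open ?S" using open_surjective_linear_image[OF open_box lin]
      linear_injective_imp_surjective[OF lin] by blast
    show "bounded ?S"
      by (intro bounded_linear_image bounded_box) (simp add: lin linear_conv_bounded_linear[symmetric])
  next
    fix x y assume xy: "x \<in> ?S" "y \<in> ?S" "x - y \<in> integer_points"
    then obtain a b where ab: "a \<in> box 0 1" "b \<in> box 0 1" "x = B *v a" "y = B *v b" by blast
    have "\<bar>(a - b) $ i\<bar> < 1" for i
      using ab(1,2) by (simp add: mem_box_cart abs_less_iff) (smt (verit))
    moreover have "x - y = B *v (a - b)" by (simp add: ab matrix_vector_mult_diff_distrib)
    ultimately have "x - y = 0" using adm xy by simp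
    then show "x = y" by simp
  qed
  also have "measure lebesgue ?S = \<bar>det B\<bar> * measure lebesgue (box 0 1 :: (real ^ ('n :: _)) set)"
    using measure_linear_image[OF lin, of "box 0 1"] by simp
  also have "measure lebesgue (box 0 1 :: (real ^ ('n :: _)) set) = 1"  by (rule lebesgue_unit_cube)
  finally show ?thesis by simp
qed

section \<open>Determinants and an ellipsoid in place of the body\<close>

text \<open>A weak form of Hadamard's inequality: each of the n! terms of the expansion is bounded
  by the product of the row norms.\<close>

lemma det_le_fact_prod:
  fixes M :: "real ^ 'n ^ 'n"
  shows "\<bar>det M\<bar> \<le> fact CARD('n) * (\<Prod>i\<in>UNIV. norm (row i M))"
proof -
  have "\<bar>det M\<bar> \<le> (\<Sum>p\<in>{p. p permutes (UNIV::'n set)}. \<bar>of_int (sign p) * (\<Prod>i\<in>UNIV. M $ i $ p i)\<bar>)"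
    unfolding det_def by (rule sum_abs)
  also have "\<dots> \<le> (\<Sum>p\<in>{p. p permutes (UNIV::'n set)}. \<Prod>i\<in>UNIV. norm (row i M))"
  proof (rule sum_mono)
    fix p
    have "\<bar>M $ i $ p i\<bar> \<le> norm (row i M)" for i
      using component_le_norm_cart[of "row i M" "p i"] by (simp add: row_def)
    then show "\<bar>of_int (sign p) * (\<Prod>i\<in>UNIV. M $ i $ p i)\<bar> \<le> (\<Prod>i\<in>UNIV. norm (row i M))"
      by (auto simp: abs_mult abs_prod sign_def intro!: prod_mono)
  qed
  also have "\<dots> = fact CARD('n) * (\<Prod>i\<in>UNIV. norm (row i M))"
    by (simp add: card_permutations)
  finally show ?thesis .
qed

lemma diagonal_matrix_mult_nth:
  fixes y :: "real ^ 'n"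
  shows "((\<chi> i j. if i = j then w i else 0) *v y) $ i = w i * y $ i"
proof -
  have "(\<Sum>j\<in>UNIV. (if i = j then w i else 0) * y $ j) = (\<Sum>j\<in>UNIV. if j = i then w i * y $ i else 0)"
    by (intro sum.cong) auto
  then show ?thesis by (simp add: matrix_vector_mult_def)
qed

text \<open>Rotate \<open>u\<close> to a coordinate axis and stretch that axis by
  \<open>exp q\<close>. The image norm is the Euclidean combination of the component orthogonal to
  \<open>u\<close> and of e^q |x . u|, hence comparable with the gauge.\<close>

lemma stretch_matrix:
  fixes u :: "real ^ 'n"
  assumes u: "norm u = 1" and q: "0 \<le> q"
  obtains A :: "real ^ 'n ^ 'n" where "\<bar>det A\<bar> = exp q"
    "\<And>x. body_norm u q x \<le> norm (A *v x)" "\<And>x. norm (A *v x) \<le> 2 * body_norm u q x"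
proof -
  obtain k :: 'n where True by blast
  obtain R where R: "orthogonal_matrix R" "R *v axis k 1 = u"
    using orthogonal_matrix_exists_basis[OF u, of k] by metis
  define D :: "real ^ 'n ^ 'n" where "D = (\<chi> i j. if i = j then (if i = k then exp q else 1) else 0)"
  define A where "A = D ** transpose R"
  have "det D = (\<Prod>i\<in>UNIV. if i = k then exp q else 1)"
    by (subst det_diagonal) (auto simp: D_def)
  then have detD: "det D = exp q" by (simp add: prod.delta)
  have "\<bar>det R\<bar> = 1" using det_orthogonal_matrix[OF R(1)] by auto
  then have dA: "\<bar>det A\<bar> = exp q" by (simp add: A_def det_mul detD abs_mult)
  have key: "body_norm u q x \<le> norm (A *v x) \<and> norm (A *v x) \<le> 2 * body_norm u q x" for x
  proof -
    define y where "y = transpose R *v x"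
    have ot: "orthogonal_transformation ((*v) (transpose R))"
      using R(1) by (simp add: orthogonal_transformation_matrix orthogonal_matrix_transpose)
    then have ny: "norm y = norm x" unfolding y_def by (rule orthogonal_transformation_norm)
    have "y $ k = y \<bullet> axis k 1" by (simp add: inner_axis)
    also have "\<dots> = x \<bullet> (R *v axis k 1)"
      unfolding y_def by (metis dot_lmul_matrix transpose_matrix_vector)
    finally have yk: "y $ k = x \<bullet> u" using R(2) by simp
    have Ax: "A *v x = D *v y"
      unfolding A_def y_def by (rule matrix_vector_mul_assoc[symmetric])
    have Dy: "(D *v y) $ i = (if i = k then exp q else 1) * y $ i" for i
      unfolding D_def by (rule diagonal_matrix_mult_nth)
    have q1: "1 \<le> exp q" using q by simp
    have "norm y \<le> norm (D *v y)"
      unfolding norm_vec_def Dy using q1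
      by (intro L2_set_mono) (auto simp: abs_mult mult_le_cancel_right1)
    moreover have "exp q * \<bar>x \<bullet> u\<bar> \<le> norm (D *v y)"
      using component_le_norm_cart[of "D *v y" k] by (simp add: Dy abs_mult yk)
    moreover have "D *v y = (y - axis k (y $ k)) + axis k (exp q * y $ k)"
      by (simp add: vec_eq_iff Dy axis_def)
    then have "norm (D *v y) \<le> norm (y - axis k (y $ k)) + norm (axis k (exp q * y $ k))"
      using norm_triangle_ineq by metis
    moreover have "norm (axis k (exp q * y $ k)) = exp q * \<bar>x \<bullet> u\<bar>"
    proof -
      have "axis k (exp q * y $ k) = (exp q * y $ k) *\<^sub>R (axis k 1 :: real ^ 'n)"
        by (simp add: vec_eq_iff axis_def)
      then show ?thesis by (simp add: yk abs_mult norm_axis_1)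
    qed
    moreover have "norm (y - axis k (y $ k)) \<le> norm y"
      unfolding norm_vec_def by (intro L2_set_mono) (auto simp: axis_def)
    ultimately show ?thesis unfolding Ax body_norm_def ny[symmetric] by auto
  qed
  show thesis using that[OF dA] key by blast
qed

section \<open>Minkowski's second theorem with a weak constant\<close>

text \<open>The points are chosen one after another: those of size at most e^{L_k} span dimension at
  least k, so one of them avoids the span of the k - 1 points found before.\<close>

lemma minimal_points:
  fixes u :: "real ^ 'n"
  assumes u: "norm u = 1" and q: "0 \<le> q"
  obtains x :: "nat \<Rightarrow> real ^ 'n" where
    "\<And>k. k \<in> {1..CARD('n)} \<Longrightarrow> x k \<in> short_points u q (exp (log_minimum u k q))"
    "\<And>k. k \<in> {1..CARD('n)} \<Longrightarrow> x k \<notin> span (x ` {1..<k})"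
proof -
  let ?P = "\<lambda>x m. \<forall>k\<in>{1..m}. x k \<in> short_points u q (exp (log_minimum u k q)) \<and>
      x k \<notin> span (x ` {1..<k})"
  have "\<exists>x. ?P x m" if "m \<le> CARD('n)" for m
    using that
  proof (induction m)
    case 0
    then show ?case by simp
  next
    case (Suc m)
    then obtain x where x: "?P x m" by auto
    have "dim (span (x ` {1..<Suc m})) \<le> card (x ` {1..<Suc m})"
      by (simp add: dim_span dim_le_card')
    also have "\<dots> \<le> m" using card_image_le[of "{1..<Suc m}" x] by simp
    also have "Suc m \<le> dim (short_points u q (exp (log_minimum u (Suc m) q)))"
      using log_minimum_le_iff[OF u q, of "Suc m" "log_minimum u (Suc m) q"] Suc by simp
    ultimately have "\<not> short_points u q (exp (log_minimum u (Suc m) q)) \<subseteq> span (x ` {1..<Suc m})"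
      by (meson dim_subset not_less_eq_eq order_trans)
    then obtain v where v: "v \<in> short_points u q (exp (log_minimum u (Suc m) q))"
      "v \<notin> span (x ` {1..<Suc m})" by blast
    have "(x(Suc m := v)) ` {1..<k} = x ` {1..<k}" if "k \<le> Suc m" for k
      using that by (intro image_cong) auto
    then have "?P (x(Suc m := v)) (Suc m)" using x v by (auto simp: le_Suc_eq)
    then show ?case by blast
  qed
  then show thesis using that by blast
qed

lemma independent_of_not_in_span:
  fixes x :: "nat \<Rightarrow> 'a :: real_vector"
  assumes "\<And>k. k \<in> {1..n} \<Longrightarrow> x k \<notin> span (x ` {1..<k})" "m \<le> n"
  shows "inj_on x {1..m} \<and> independent (x ` {1..m})"
  using assms(2)
proof (induction m)
  case (Suc m)
  have e: "{1..<Suc m} = {1..m}" "{1..Suc m} = insert (Suc m) {1..m}" by auto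
  have s: "x (Suc m) \<notin> span (x ` {1..m})" using assms(1)[of "Suc m"] Suc.prems e(1) by auto
  have "inj_on x {1..m}" "independent (x ` {1..m})" using Suc by auto
  moreover have "x (Suc m) \<notin> x ` {1..m}" using s by (meson span_base)
  ultimately show ?case using s unfolding e(2) by (simp add: independent_insert)
qed (simp add: independent_empty)

text \<open>If \<open>z\<close> were shorter, the points of its size would span a dimension d < i.
  The first d chosen points are among them and are independent, so they span all of these,
  \<open>z\<close> included.\<close>

lemma body_norm_ge_minimum:
  fixes u :: "real ^ 'n"
  assumes u: "norm u = 1" and q: "0 \<le> q"
    and x1: "\<And>k. k \<in> {1..CARD('n)} \<Longrightarrow> x k \<in> short_points u q (exp (log_minimum u k q))"
    and x2: "\<And>k. k \<in> {1..CARD('n)} \<Longrightarrow> x k \<notin> span (x ` {1..<k})"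
    and z: "z \<in> integer_points" "z \<notin> span (x ` {1..<i})" and i: "i \<in> {1..CARD('n)}"
  shows "exp (log_minimum u i q) \<le> body_norm u q z"
proof (rule ccontr)
  assume neg: "\<not> ?thesis"
  have "z \<noteq> 0" using z(2) span_zero by blast
  then have pos: "0 < body_norm u q z" using one_le_norm_integer_points[OF z(1)] by (simp add: body_norm_def less_max_iff_disj)
  define M where "M = ln (body_norm u q z)"
  have eM: "exp M = body_norm u q z" using pos by (simp add: M_def)
  define d where "d = dim (short_points u q (exp M))"
  have "M < log_minimum u i q" using neg eM by (metis exp_less_cancel_iff not_le)
  then have di: "d < i" using i log_minimum_le_iff[OF u q, of i M] by (auto simp: d_def)
  have "x k \<in> short_points u q (exp M)" if "k \<in> {1..d}" for k
  proof -
    have "log_minimum u k q \<le> M" using that i di by (subst log_minimum_le_iff[OF u q]) (auto simp: d_def)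
    then show ?thesis using x1[of k] that i di short_points_mono[of "exp (log_minimum u k q)" "exp M" u q] by auto
  qed
  then have sub: "x ` {1..d} \<subseteq> short_points u q (exp M)" by blast
  have ind: "inj_on x {1..d} \<and> independent (x ` {1..d})"
    using di i by (intro independent_of_not_in_span[OF x2]) auto
  then have "short_points u q (exp M) \<subseteq> span (x ` {1..d})"
    using sub by (intro card_ge_dim_independent) (auto simp: card_image d_def)
  moreover have "z \<in> short_points u q (exp M)" using z eM by (simp add: short_points_def)
  moreover have "x ` {1..d} \<subseteq> x ` {1..<i}" using di by auto
  ultimately show False using z(2) span_mono by blast
qed

text \<open>The matrix \<open>X\<close> of minimal points is integral and regular, so |det X| \<ge>
  1. Stretching multiplies this by e^q, while the weak Hadamard inequality bounds the result by n!
  2^n times the product of the e^{L_k}.\<close>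

lemma sum_log_minimum_lower:
  fixes u :: "real ^ 'n"
  assumes u: "norm u = 1" and q: "0 \<le> q"
  shows "q \<le> (\<Sum>j=1..CARD('n). log_minimum u j q) + 2 * real CARD('n) * ln (real (max 2 CARD('n)))"
proof -
  let ?n = "CARD('n)"
  obtain x :: "nat \<Rightarrow> real ^ 'n" where x1: "\<And>k. k \<in> {1..?n} \<Longrightarrow> x k \<in> short_points u q (exp (log_minimum u k q))"
    and x2: "\<And>k. k \<in> {1..?n} \<Longrightarrow> x k \<notin> span (x ` {1..<k})"
    using minimal_points[OF u q] by blast
  obtain A :: "real ^ 'n ^ 'n" where A: "\<bar>det A\<bar> = exp q"
    "\<And>x. body_norm u q x \<le> norm (A *v x)" "\<And>x. norm (A *v x) \<le> 2 * body_norm u q x"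
    using stretch_matrix[OF u q] by blast
  obtain h :: "'n \<Rightarrow> nat" where h: "bij_betw h UNIV {1..?n}"
    using finite_same_card_bij[of "UNIV :: 'n set" "{1..?n}"] by auto
  have hi: "h i \<in> {1..?n}" for i using h by (auto simp: bij_betw_def)
  define X :: "real ^ 'n ^ 'n" where "X = (\<chi> i. x (h i))"
  have "rows X = x ` (h ` UNIV)" by (auto simp: rows_def row_def X_def)
  then have "rows X = x ` {1..?n}" using bij_betw_imp_surj_on[OF h] by simp
  moreover have ind: "inj_on x {1..?n} \<and> independent (x ` {1..?n})"
    by (intro independent_of_not_in_span[OF x2]) auto
  ultimately have "rank X = ?n"
    by (simp add: row_rank_def dim_eq_card_independent card_image)
  then have nz: "det X \<noteq> 0" using det_eq_0_rank[of X] by simp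
  have "det X \<in> \<int>"
    unfolding det_def X_def using x1 hi
    by (intro Ints_sum Ints_mult Ints_prod) (auto simp: short_points_def integer_points_def)
  then have "1 \<le> \<bar>det X\<bar>" using nz by (intro Ints_nonzero_abs_ge1)
  then have "exp q \<le> \<bar>det (X ** transpose A)\<bar>" using A(1) by (simp add: det_mul abs_mult)
  also have "\<dots> \<le> fact ?n * (\<Prod>i\<in>UNIV. norm (row i (X ** transpose A)))" by (rule det_le_fact_prod)
  also have "(\<Prod>i\<in>UNIV. norm (row i (X ** transpose A))) \<le> (\<Prod>i\<in>UNIV. 2 * exp (log_minimum u (h i) q))"
  proof (intro prod_mono conjI)
    fix i :: 'n
    have "row i (X ** transpose A) = A *v x (h i)"
      by (simp add: vec_eq_iff row_def matrix_matrix_mult_def matrix_vector_mult_def X_def transpose_def mult.commute)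
    then have "norm (row i (X ** transpose A)) \<le> 2 * body_norm u q (x (h i))" using A(3) by simp
    also have "\<dots> \<le> 2 * exp (log_minimum u (h i) q)" using x1[OF hi] by (simp add: short_points_def)
    finally show "norm (row i (X ** transpose A)) \<le> 2 * exp (log_minimum u (h i) q)" .
  qed simp
  also have "\<dots> = 2 ^ ?n * exp (\<Sum>i\<in>UNIV. log_minimum u (h i) q)"
    by (simp add: prod.distrib exp_sum)
  also have "(\<Sum>i\<in>UNIV. log_minimum u (h i) q) = (\<Sum>j=1..?n. log_minimum u j q)"
    using sum.reindex_bij_betw[OF h, of "\<lambda>j. log_minimum u j q"] by simp
  finally have le: "exp q \<le> fact ?n * (2 ^ ?n * exp (\<Sum>j=1..?n. log_minimum u j q))" by simp
  \<comment> \<open>The maximum with 2 lets the n-th power of one base bound both n! and 2^n, also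
    for n = 1.\<close>
  let ?m = "real (max 2 ?n)"
  have "(fact ?n :: real) \<le> real ?n ^ ?n" by (metis fact_le_power of_nat_power)
  also have "\<dots> \<le> ?m ^ ?n" by (intro power_mono) auto
  finally have "(fact ?n :: real) \<le> ?m ^ ?n" .
  moreover have "(2::real) ^ ?n \<le> ?m ^ ?n" by (intro power_mono) auto
  ultimately have "fact ?n * (2 ^ ?n * exp (\<Sum>j=1..?n. log_minimum u j q))
      \<le> ?m ^ ?n * (?m ^ ?n * exp (\<Sum>j=1..?n. log_minimum u j q))"
    by (intro mult_mono) auto
  also have "?m ^ ?n = exp (real ?n * ln ?m)" by (simp add: exp_of_nat_mult)
  also have "exp (real ?n * ln ?m) * (exp (real ?n * ln ?m) * exp (\<Sum>j=1..?n. log_minimum u j q))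
    = exp ((\<Sum>j=1..?n. log_minimum u j q) + 2 * real ?n * ln ?m)"
    by (simp flip: exp_add)
  finally have "exp q \<le> exp ((\<Sum>j=1..?n. log_minimum u j q) + 2 * real ?n * ln ?m)"
    using le by linarith
  then show ?thesis by simp
qed

text \<open>Orthonormalize the images \<open>A x_k\<close> to vectors \<open>f k\<close>, and
  consider the box with half-edges \<open>\<mu> k / n\<close> along them. Pulled back by
  \<open>A\<close> it contains no nonzero integer point in its interior, and the volume bound then
  limits the product of the \<open>\<mu> k\<close>.\<close>

lemma sum_log_minimum_upper_wellorder:
  fixes u :: "real ^ 'n :: {finite, wellorder}"
  assumes u: "norm u = 1" and q: "0 \<le> q"
  shows "(\<Sum>j=1..CARD('n). log_minimum u j q) \<le> q + real CARD('n) * ln (real CARD('n))"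
proof -
  let ?n = "CARD('n)"
  define \<mu> where "\<mu> j = exp (log_minimum u j q)" for j
  obtain x :: "nat \<Rightarrow> real ^ ('n :: _)" where x1: "\<And>k. k \<in> {1..?n} \<Longrightarrow> x k \<in> short_points u q (exp (log_minimum u k q))"
    and x2: "\<And>k. k \<in> {1..?n} \<Longrightarrow> x k \<notin> span (x ` {1..<k})"
    using minimal_points[OF u q] by blast
  obtain A :: "real ^ ('n :: _) ^ ('n :: _)" where A: "\<bar>det A\<bar> = exp q"
    "\<And>x. body_norm u q x \<le> norm (A *v x)" "\<And>x. norm (A *v x) \<le> 2 * body_norm u q x"
    using stretch_matrix[OF u q] by blast
  obtain A' where A': "A' ** A = mat 1" "A ** A' = mat 1"
    using A(1) by (metis abs_zero exp_not_eq_zero invertible_def invertible_det_nz)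
  obtain h :: "'n :: _ \<Rightarrow> nat" where h: "bij_betw h UNIV {1..?n}"
    using finite_same_card_bij[of "UNIV :: 'n :: _ set" "{1..?n}"] by auto
  have hi: "h i \<in> {1..?n}" for i using h by (auto simp: bij_betw_def)
  have hinj: "h i = h k \<longleftrightarrow> i = k" for i k by (rule inj_eq[OF bij_betw_imp_inj_on[OF h]])
  \<comment> \<open>The flag spanned by the images of the minimal points; \<open>f k\<close> is a
    unit vector of \<open>W k\<close> orthogonal to \<open>W (k - 1)\<close>.\<close>
  define W where "W k = (*v) A ` span (x ` {1..k})" for k
  have W: "subspace (W k)" for k unfolding W_def
    by (intro linear_subspace_image subspace_span) simp
  have Wmono: "W k \<subseteq> W l" if "k \<le> l" for k l
    unfolding W_def using that by (intro image_mono span_mono) auto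
  have "\<exists>f. f \<in> W k \<and> norm f = 1 \<and> (\<forall>y\<in>W (k - 1). f \<bullet> y = 0)" if k: "k \<in> {1..?n}" for k
  proof -
    have "W (k - 1) \<noteq> W k"
    proof
      assume "W (k - 1) = W k"
      moreover have "A *v x k \<in> W k" unfolding W_def using k by (intro imageI span_base) auto
      ultimately obtain y where y: "y \<in> span (x ` {1..k - 1})" "A *v x k = A *v y" by (auto simp: W_def)
      then have "x k = y" using A' by (metis matrix_vector_mul_assoc matrix_vector_mul_lid)
      moreover have "{1..k - 1} = {1..<k}" using k by auto
      ultimately show False using y x2[OF k] by simp
    qed
    then have "span (W (k - 1)) \<subset> span (W k)"
      using W Wmono[of "k - 1" k] by (simp add: span_eq_iff[THEN iffD2] psubset_eq)
    then obtain g where g: "g \<noteq> 0" "g \<in> span (W k)" "\<And>y. y \<in> span (W (k - 1)) \<Longrightarrow> orthogonal g y"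
      using orthogonal_to_subspace_exists_gen by metis
    have "g /\<^sub>R norm g \<in> W k" using g W subspace_scale by (metis span_eq_iff)
    moreover have "(g /\<^sub>R norm g) \<bullet> y = 0" if "y \<in> W (k - 1)" for y
      using g(3)[of y] that span_base by (auto simp: orthogonal_def)
    ultimately show ?thesis using g(1) by (intro exI[of _ "g /\<^sub>R norm g"]) auto
  qed
  then obtain f where f: "\<And>k. k \<in> {1..?n} \<Longrightarrow> f k \<in> W k" "\<And>k. k \<in> {1..?n} \<Longrightarrow> norm (f k) = 1"
    "\<And>k y. k \<in> {1..?n} \<Longrightarrow> y \<in> W (k - 1) \<Longrightarrow> f k \<bullet> y = 0" by metis
  have orth: "f k \<bullet> f l = 0" if "k \<in> {1..?n}" "l \<in> {1..?n}" "k \<noteq> l" for k l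
  proof -
    have *: "f k \<bullet> f l = 0" if "k \<in> {1..?n}" "l \<in> {1..?n}" "l < k" for k l
      by (rule f(3)[OF _ subsetD[OF Wmono f(1)]]) (use that in auto)
    show ?thesis using *[of k l] *[of l k] that by (metis inner_commute nat_neq_iff)
  qed
  define F :: "real ^ ('n :: _) ^ ('n :: _)" where "F = (\<chi> i j. f (h j) $ i)"
  define D :: "real ^ ('n :: _) ^ ('n :: _)" where "D = (\<chi> i j. if i = j then \<mu> (h i) / ?n else 0)"
  \<comment> \<open>\<open>B d\<close> is the point whose image under \<open>A\<close> has
    coordinates d_i \<mu>_i / n in the frame \<open>F\<close>.\<close>
  define B where "B = A' ** (F ** D)"
  have colF: "column j F = f (h j)" for j by (simp add: column_def F_def vec_eq_iff)
  have "orthogonal_matrix F"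
    unfolding orthogonal_matrix_orthonormal_columns colF orthogonal_def
    using f(2)[OF hi] orth[OF hi hi] by (auto simp: hinj)
  then have "\<bar>det F\<bar> = 1" using det_orthogonal_matrix by fastforce
  moreover have "det D = (\<Prod>i\<in>UNIV. \<mu> (h i) / ?n)"
    by (subst det_diagonal) (auto simp: D_def)
  moreover have "\<bar>det A'\<bar> * exp q = 1"
    using A'(1) A(1) by (metis abs_mult abs_one det_I det_mul)
  then have "\<bar>det A'\<bar> = exp (- q)" by (simp add: exp_minus field_simps)
  moreover have "(\<Prod>i\<in>UNIV. \<mu> (h i) / ?n) > 0" by (intro prod_pos) (auto simp: \<mu>_def)
  ultimately have detB: "\<bar>det B\<bar> = exp (- q) * (\<Prod>i\<in>UNIV. \<mu> (h i) / ?n)"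
    by (simp add: B_def det_mul abs_mult)
  have "\<bar>det B\<bar> \<le> 1"
  proof (rule det_le_1_of_admissible)
    show "det B \<noteq> 0" using detB by (auto simp: \<mu>_def)
  next
    fix d :: "real ^ ('n :: _)"
    assume d: "\<And>i. \<bar>d $ i\<bar> < 1" and Z: "B *v d \<in> integer_points"
    define z where "z = B *v d"
    define c where "c i = \<mu> (h i) / ?n * d $ i" for i
    have "D *v d = (\<chi> i. c i)"
      unfolding D_def vec_eq_iff diagonal_matrix_mult_nth by (simp add: c_def)
    moreover have "A *v z = F *v (D *v d)"
      unfolding z_def B_def by (simp add: matrix_vector_mul_assoc A' matrix_mul_assoc)
    ultimately have Az: "A *v z = (\<Sum>i\<in>UNIV. c i *\<^sub>R f (h i))"
      by (simp add: matrix_mult_sum colF scalar_mult_eq_scaleR)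
    show "B *v d = 0"
    proof (rule ccontr)
      assume "B *v d \<noteq> 0"
      \<comment> \<open>Let h(i) be the largest index with a nonzero coordinate. Then
        \<open>z\<close> is outside the span of the earlier minimal points, so its gauge is at least
        \<open>\<mu> (h i)\<close>; but all nonzero coordinates are less than
        \<open>\<mu> (h i) / n\<close>, which makes it shorter.\<close>
      define T where "T = {i. d $ i \<noteq> 0}"
      have "T \<noteq> {}"
      proof
        assume "T = {}"
        then have "d = 0" by (auto simp: T_def vec_eq_iff)
        then show False using \<open>B *v d \<noteq> 0\<close> by simp
      qed
      then have "Max (h ` T) \<in> h ` T" by (intro Max_in) auto
      then obtain i where i: "i \<in> T" "Max (h ` T) = h i" by auto
      have le_hi: "h k \<le> h i" if "k \<in> T" for k using that unfolding i(2)[symmetric] by (intro Max_ge) auto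
      have ck: "c k = 0" if "h i < h k" for k using le_hi[of k] that by (auto simp: T_def c_def)
      have "(A *v z) \<bullet> f (h i) = (\<Sum>k\<in>UNIV. c k * (f (h k) \<bullet> f (h i)))"
        unfolding Az by (simp add: inner_sum_left)
      also have "\<dots> = (\<Sum>k\<in>UNIV. if k = i then c i else 0)"
        using f(2)[OF hi] orth[OF hi hi] by (intro sum.cong refl) (auto simp: hinj norm_eq_1)
      finally have "(A *v z) \<bullet> f (h i) = c i" by simp
      moreover have "c i \<noteq> 0" using i(1) by (simp add: c_def T_def \<mu>_def)
      ultimately have "A *v z \<notin> W (h i - 1)" using f(3)[OF hi] by (metis inner_commute)
      moreover have "{1..h i - 1} = {1..<h i}" using hi[of i] by auto
      ultimately have "z \<notin> span (x ` {1..<h i})" by (auto simp: W_def)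
      then have "\<mu> (h i) \<le> body_norm u q z"
        unfolding \<mu>_def using Z hi by (intro body_norm_ge_minimum[OF u q x1 x2]) (auto simp: z_def)
      also have "\<dots> \<le> norm (A *v z)" by (rule A(2))
      also have "\<dots> \<le> (\<Sum>k\<in>UNIV. \<bar>c k\<bar>)"
        unfolding Az using f(2)[OF hi] by (intro order_trans[OF norm_sum]) simp
      also have "\<dots> < (\<Sum>k\<in>(UNIV:: 'n :: _ set). \<mu> (h i) / ?n)"
      proof (rule sum_strict_mono)
        fix k
        have "\<bar>c k\<bar> < \<mu> (h k) / ?n" using d[of k] by (simp add: c_def abs_mult \<mu>_def field_simps)
        moreover have "\<mu> (h k) \<le> \<mu> (h i)" if "h k \<le> h i"
          unfolding \<mu>_def using log_minimum_mono_index[OF u q, of "h k" "h i"] hi[of k] hi[of i] that by auto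
        moreover have "0 < \<mu> (h i) / ?n" by (simp add: \<mu>_def)
        ultimately show "\<bar>c k\<bar> < \<mu> (h i) / ?n"
          using ck[of k] by (cases "h i < h k") (auto simp: divide_right_mono intro: less_le_trans)
      qed auto
      also have "\<dots> = \<mu> (h i)" by simp
      finally show False by simp
    qed
  qed
  then have "exp (- q) * (\<Prod>i\<in>UNIV. \<mu> (h i) / ?n) \<le> 1" using detB by simp
  moreover have "(\<Prod>i\<in>UNIV. \<mu> (h i) / ?n) = (\<Prod>i\<in>UNIV. \<mu> (h i)) / real ?n ^ ?n"
    by (simp add: prod_dividef)
  moreover have "(\<Prod>i\<in>UNIV. \<mu> (h i)) = exp (\<Sum>j=1..?n. log_minimum u j q)"
    using sum.reindex_bij_betw[OF h, of "\<lambda>j. log_minimum u j q"] by (simp add: \<mu>_def flip: exp_sum)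
  moreover have "real ?n ^ ?n = exp (real ?n * ln (real ?n))" by (simp add: exp_of_nat_mult)
  ultimately have "exp (- q + (\<Sum>j=1..?n. log_minimum u j q) - real ?n * ln (real ?n)) \<le> 1"
    by (simp add: exp_add exp_diff exp_minus field_simps)
  then show ?thesis by simp
qed

text \<open>The library proves the formula for the volume of a linear image only for a well-ordered index type.\<close>

typedef 'a ordered_copy = "UNIV :: 'a set"
  by simp

lemma bij_Rep_ordered_copy: "bij Rep_ordered_copy"
  by (metis Abs_ordered_copy_inverse Rep_ordered_copy_inverse UNIV_I bijI')

instance ordered_copy :: (finite) finite
proof
  show "finite (UNIV :: 'a ordered_copy set)"
    by (simp add: bij_betw_finite[OF bij_Rep_ordered_copy])
qed

definition ordered_copy_index :: "'a :: finite ordered_copy \<Rightarrow> nat" where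
  "ordered_copy_index = (SOME f. inj f)"

lemma inj_ordered_copy_index: "inj ordered_copy_index"
  unfolding ordered_copy_index_def
  using finite_imp_inj_to_nat_seg[OF finite[of UNIV]] by (metis someI_ex)

instantiation ordered_copy :: (finite) linorder
begin

definition "x \<le> y \<longleftrightarrow> ordered_copy_index x \<le> ordered_copy_index y"
definition "x < y \<longleftrightarrow> ordered_copy_index x < ordered_copy_index y"

instance
  by standard (auto simp: less_eq_ordered_copy_def less_ordered_copy_def
      intro: injD[OF inj_ordered_copy_index])

end

instance ordered_copy :: (finite) wellorder
proof (rule wf_wellorderI)
  show "wf {(x :: 'a ordered_copy, y). x < y}"
    unfolding less_ordered_copy_def using wf_inv_image[OF wf_less, of ordered_copy_index]
    by (simp add: inv_image_def)
qed intro_classes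

text \<open>Relabelling the coordinates is an isometry that respects integer points, so
  \<open>\<phi> u\<close> has the same minima as \<open>u\<close>.\<close>

lemma sum_log_minimum_upper:
  fixes u :: "real ^ 'n"
  assumes u: "norm u = 1" and q: "0 \<le> q"
  shows "(\<Sum>j=1..CARD('n). log_minimum u j q) \<le> q + real CARD('n) * ln (real CARD('n))"
proof -
  define \<phi> :: "real ^ 'n \<Rightarrow> real ^ 'n ordered_copy" where "\<phi> x = (\<chi> i. x $ Rep_ordered_copy i)" for x
  have card: "CARD('n ordered_copy) = CARD('n)"
    using bij_betw_same_card[OF bij_Rep_ordered_copy] .
  have re: "(\<Sum>i\<in>UNIV. g (Rep_ordered_copy i)) = (\<Sum>i\<in>UNIV. g i)" for g :: "'n \<Rightarrow> real"
    by (rule sum.reindex_bij_betw[OF bij_Rep_ordered_copy])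
  have inner: "\<phi> x \<bullet> \<phi> y = x \<bullet> y" for x y
    using re[of "\<lambda>i. x $ i * y $ i"] by (simp add: \<phi>_def inner_vec_def)
  then have nrm: "norm (\<phi> x) = norm x" for x by (simp add: norm_eq_sqrt_inner)
  have lin: "linear \<phi>" by (auto simp: \<phi>_def vec_eq_iff intro!: linearI)
  have inj: "inj \<phi>" using nrm by (subst linear_injective_0[OF lin]) (metis norm_eq_zero)
  have surj: "\<phi> (\<chi> i. y $ Abs_ordered_copy i) = y" for y
    by (simp add: \<phi>_def vec_eq_iff Rep_ordered_copy_inverse)
  have int: "\<phi> x \<in> integer_points \<longleftrightarrow> x \<in> integer_points" for x
    by (auto simp: integer_points_def \<phi>_def) (metis Abs_ordered_copy_inverse UNIV_I)
  have "short_points (\<phi> u) q r = \<phi> ` short_points u q r" for r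
  proof -
    have "y \<in> short_points (\<phi> u) q r \<longleftrightarrow> y \<in> \<phi> ` short_points u q r" for y
    proof -
      define x where "x = (\<chi> i. y $ Abs_ordered_copy i)"
      have "y = \<phi> x" by (simp add: x_def surj)
      then show ?thesis using inj by (simp add: short_points_def body_norm_def inner nrm int inj_image_mem_iff)
    qed
    then show ?thesis by blast
  qed
  then have dim: "dim (short_points (\<phi> u) q r) = dim (short_points u q r)" for r
    using dim_image_eq[OF lin inj_on_subset[OF inj subset_UNIV]] by metis
  have "log_minimum (\<phi> u) j q = log_minimum u j q" for j
    unfolding log_minimum_def has_indep_points_iff dim ..
  then show ?thesis
    using sum_log_minimum_upper_wellorder[of "\<phi> u" q] u q by (simp add: nrm card)
qed

section \<open>Tracking a family of minima by grid points\<close>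

definition rank_gap :: "(nat \<Rightarrow> nat \<Rightarrow> real) \<Rightarrow> nat \<Rightarrow> nat \<Rightarrow> real" where
  "rank_gap P j m = P (Suc j) m - P j m"

text \<open>Discrete model of the minima: \<open>P j m\<close> is L_j at the m-th sampled time in
  units of the mesh, \<open>up\<close> is steepness, and \<open>\<eta>\<close> is the time step in
  the same units. In the static axioms nothing is asked at \<open>m2\<close>, where the gap may have
  closed; the factor 3 pays for that last step and for the constant \<open>ln 4\<close>.
  \<open>eta_small\<close> keeps the total drift below one grid unit.\<close>

locale minima_process =
  fixes n :: nat and P :: "nat \<Rightarrow> nat \<Rightarrow> real" and up :: "nat \<Rightarrow> nat \<Rightarrow> bool" and \<eta> :: real
  assumes n_pos: "1 \<le> n" and eta_pos: "0 < \<eta>" and eta_small: "8 * real n * \<eta> \<le> 1"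
    and P_nonneg: "j \<in> {1..n} \<Longrightarrow> 0 \<le> P j m"
    and P_Suc: "j \<in> {1..n} \<Longrightarrow> P j m \<le> P j (Suc m)"
    and P_lipschitz: "j \<in> {1..n} \<Longrightarrow> P j (Suc m) \<le> P j m + \<eta>"
    and P_sorted: "i \<in> {1..n} \<Longrightarrow> j \<in> {1..n} \<Longrightarrow> i \<le> j \<Longrightarrow> P i m \<le> P j m"
    and P_unbounded: "\<exists>m. B < (\<Sum>j=1..n. P j m)"
    and up_Suc: "\<lbrakk>1 \<le> j; j < n; \<eta> < rank_gap P j m; \<eta> < rank_gap P j (Suc m); up j m\<rbrakk> \<Longrightarrow> up j (Suc m)"
    and up_mono: "\<lbrakk>1 \<le> i; i \<le> j; j < n; \<eta> < rank_gap P i m; \<eta> < rank_gap P j m; up i m\<rbrakk> \<Longrightarrow> up j m"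
    and static_below: "\<lbrakk>1 \<le> i; i \<le> j; j < n; m1 \<le> m2; \<forall>m\<in>{m1..<m2}. \<eta> < rank_gap P j m \<and> \<not> up j m\<rbrakk>
        \<Longrightarrow> P i m2 \<le> P i m1 + 3 * \<eta>"
    and static_above: "\<lbrakk>1 \<le> j; j < i; i \<le> n; m1 \<le> m2; \<forall>m\<in>{m1..<m2}. \<eta> < rank_gap P j m \<and> up j m\<rbrakk>
        \<Longrightarrow> P i m2 \<le> P i m1 + 3 * \<eta>"
begin

section \<open>Drift of the ranks outside the growing cluster\<close>

lemma P_mono: "j \<in> {1..n} \<Longrightarrow> m \<le> m' \<Longrightarrow> P j m \<le> P j m'"
  using lift_Suc_mono_le[of "P j"] P_Suc by blast

text \<open>
  \<open>up j m\<close> says that at time \<open>m\<close> the growth takes place at a rank \<open>\<le> j\<close>; this is meaningful only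
  when the gap at \<open>j\<close> is larger than \<open>\<eta>\<close>. The factor 5 leaves room for a gap to stay above \<open>\<eta>\<close>
  while a minimum drifts by up to \<open>3 \<eta>\<close> in a static phase.
\<close>
definition wide :: "nat \<Rightarrow> nat \<Rightarrow> bool" where
  "wide j m \<longleftrightarrow> 5 * \<eta> < rank_gap P j m"

text \<open>Position of rank j relative to the growing cluster: \<open>below\<close> if a wide gap
  at or over j has the growth beyond it, \<open>above\<close> if a wide gap under j has the growth
  under it, \<open>active\<close> if no wide gap separates j from the growth.\<close>

definition below :: "nat \<Rightarrow> nat \<Rightarrow> bool" where
  "below j m \<longleftrightarrow> (\<exists>i. j \<le> i \<and> i < n \<and> wide i m \<and> \<not> up i m)"

definition above :: "nat \<Rightarrow> nat \<Rightarrow> bool" where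
  "above j m \<longleftrightarrow> (\<exists>k. 1 \<le> k \<and> k < j \<and> wide k m \<and> up k m)"

definition active :: "nat \<Rightarrow> nat \<Rightarrow> bool" where
  "active j m \<longleftrightarrow> \<not> below j m \<and> \<not> above j m"

lemma wide_gap: "wide j m \<Longrightarrow> \<eta> < rank_gap P j m"
  unfolding wide_def using eta_pos by linarith

text \<open>The witness of \<open>below\<close> can only be replaced by a smaller one as time goes on, so the
  total drift stays bounded.\<close>
lemma growth_below_witness:
  assumes "1 \<le> j" "j \<le> i" "i < n" "wide i m1" "\<not> up i m1" "m1 \<le> m2"
    and "\<forall>m\<in>{m1..<m2}. below j m"
  shows "P j m2 \<le> P j m1 + 3 * \<eta> * real (Suc i - j)"
  using assms
proof (induction i arbitrary: m1 rule: less_induct)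
  case (less i)
  define Q where "Q m \<longleftrightarrow> \<eta> < rank_gap P i m \<and> \<not> up i m" for m
  show ?case
  proof (cases "\<forall>m\<in>{m1..<m2}. Q m")
    case True
    then have "P j m2 \<le> P j m1 + 3 * \<eta>"
      using less.prems unfolding Q_def by (intro static_below[of j i]) auto
    moreover have "3 * \<eta> * 1 \<le> 3 * \<eta> * real (Suc i - j)"
      using less.prems eta_pos by (intro mult_left_mono) auto
    ultimately show ?thesis by simp
  next
    case False
    \<comment> \<open>The first time at which the witness \<open>i\<close> fails; up to then the
      ranks \<le> \<open>i\<close> are static.\<close>
    define m' where "m' = (LEAST m. m1 \<le> m \<and> m < m2 \<and> \<not> Q m)"
    have "\<exists>m. m1 \<le> m \<and> m < m2 \<and> \<not> Q m" using False by auto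
    then have m': "m1 \<le> m'" "m' < m2" "\<not> Q m'" unfolding m'_def by (metis (mono_tags, lifting) LeastI)+
    have before: "\<forall>m\<in>{m1..<m'}. Q m"
      using not_less_Least[of _ "\<lambda>m. m1 \<le> m \<and> m < m2 \<and> \<not> Q m"] m'(2) by (auto simp: m'_def[symmetric])
    have st: "P l m' \<le> P l m1 + 3 * \<eta>" if "1 \<le> l" "l \<le> i" for l
      using less.prems before m' that unfolding Q_def by (intro static_below[of l i]) auto
    have "P (Suc i) m1 \<le> P (Suc i) m'" using less.prems m' by (intro P_mono) auto
    \<comment> \<open>P_i has drifted by at most 3 \<eta> and P_{i+1} has not decreased, so the gap
      is still larger than 2 \<eta>. The failure therefore comes from \<open>up\<close>, and
      \<open>up_mono\<close> forces the next witness to be smaller than \<open>i\<close>.\<close>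
    then have "\<eta> < rank_gap P i m'"
      using st[of i] less.prems eta_pos by (auto simp: wide_def rank_gap_def)
    then have upi: "up i m'" using m'(3) by (simp add: Q_def)
    have "below j m'" using less.prems(7) m' by auto
    then obtain i2 where i2: "j \<le> i2" "i2 < n" "wide i2 m'" "\<not> up i2 m'"
      by (auto simp: below_def)
    have "i2 < i"
    proof (rule ccontr)
      assume "\<not> i2 < i"
      then have "up i2 m'" using less.prems i2 upi wide_gap \<open>\<eta> < rank_gap P i m'\<close>
        by (intro up_mono[of i i2]) auto
      then show False using i2 by simp
    qed
    then have "P j m2 \<le> P j m' + 3 * \<eta> * real (Suc i2 - j)"
      using less.prems i2 m' by (intro less.IH) auto
    also have "\<dots> \<le> P j m1 + 3 * \<eta> + 3 * \<eta> * real (i - j)"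
      using st[of j] less.prems eta_pos \<open>i2 < i\<close> by (intro add_mono mult_left_mono) auto
    also have "\<dots> = P j m1 + 3 * \<eta> * real (Suc i - j)"
      using less.prems by (simp add: Suc_diff_le algebra_simps)
    finally show ?thesis .
  qed
qed

lemma growth_while_below:
  assumes "j \<in> {1..n}" "m1 \<le> m2" "\<forall>m\<in>{m1..<m2}. below j m"
  shows "P j m2 \<le> P j m1 + 3 * real n * \<eta>"
proof (cases "m1 = m2")
  case True
  then show ?thesis using eta_pos by simp
next
  case False
  then have "below j m1" using assms by auto
  then obtain i where i: "j \<le> i" "i < n" "wide i m1" "\<not> up i m1"
    by (auto simp: below_def)
  then have "P j m2 \<le> P j m1 + 3 * \<eta> * real (Suc i - j)"
    using assms by (intro growth_below_witness) auto
  also have "\<dots> \<le> P j m1 + 3 * \<eta> * real n"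
    using i assms eta_pos by (intro add_left_mono mult_left_mono) auto
  finally show ?thesis by (simp add: mult_ac)
qed

text \<open>The same argument backward in time.\<close>
lemma growth_above_witness:
  assumes "j \<le> n" "1 \<le> k" "k < j" "wide k m2" "up k m2" "m1 \<le> m2"
    and "\<forall>m\<in>{m1..m2}. above j m"
  shows "P j (Suc m2) \<le> P j m1 + 3 * \<eta> * real (j - k)"
  using assms
proof (induction "j - k" arbitrary: k m2 rule: less_induct)
  case less
  define Q where "Q m \<longleftrightarrow> \<eta> < rank_gap P k m \<and> up k m" for m
  show ?case
  proof (cases "\<forall>m\<in>{m1..m2}. Q m")
    case True
    then have "P j (Suc m2) \<le> P j m1 + 3 * \<eta>"
      using less.prems unfolding Q_def by (intro static_above[of k j]) auto
    moreover have "3 * \<eta> * 1 \<le> 3 * \<eta> * real (j - k)"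
      using less.prems eta_pos by (intro mult_left_mono) auto
    ultimately show ?thesis by simp
  next
    case False
    \<comment> \<open>The last time at which \<open>k\<close> fails; afterwards the ranks over
      \<open>k\<close> are static.\<close>
    define m' where "m' = (GREATEST m. m1 \<le> m \<and> m \<le> m2 \<and> \<not> Q m)"
    have "\<exists>m. m1 \<le> m \<and> m \<le> m2 \<and> \<not> Q m" using False by auto
    then have "m1 \<le> m' \<and> m' \<le> m2 \<and> \<not> Q m'" unfolding m'_def by (rule GreatestI_ex_nat) auto
    then have m': "m1 \<le> m'" "m' \<le> m2" "\<not> Q m'" by auto
    have after: "\<forall>m\<in>{Suc m'..m2}. Q m"
    proof
      fix m assume m: "m \<in> {Suc m'..m2}"
      show "Q m"
      proof (rule ccontr)
        assume "\<not> Q m"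
        then have "m \<le> m'" unfolding m'_def using m m'(1)
          by (intro Greatest_le_nat[of _ _ m2]) auto
        then show False using m by simp
      qed
    qed
    have "Q m2" using less.prems wide_gap by (simp add: Q_def)
    then have "m' < m2" using m' by (metis le_neq_implies_less)
    have st: "P l m \<le> P l (Suc m') + 3 * \<eta>" if "k < l" "l \<le> n" "Suc m' \<le> m" "m \<le> Suc m2" for l m
      using less.prems after that unfolding Q_def by (intro static_above[of k l]) auto
    \<comment> \<open>Going back from \<open>m2\<close> to \<open>m'\<close>, the gap at
      \<open>k\<close> loses at most 3 \<eta> by drift and \<eta> in the single step after
      \<open>m'\<close>. This uses the threshold 5 \<eta> in full.\<close>
    have "P (Suc k) (Suc m') \<le> P (Suc k) m' + \<eta>" "P k m' \<le> P k m2"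
      using less.prems \<open>m' < m2\<close> by (auto intro!: P_lipschitz P_mono)
    then have gk: "\<eta> < rank_gap P k m'"
      using st[of "Suc k" m2] less.prems \<open>m' < m2\<close> by (auto simp: wide_def rank_gap_def)
    then have nup: "\<not> up k m'" using m'(3) by (simp add: Q_def)
    have "above j m'" using less.prems(7) m' by auto
    then obtain k2 where k2: "1 \<le> k2" "k2 < j" "wide k2 m'" "up k2 m'"
      by (auto simp: above_def)
    have "k < k2"
    proof (rule ccontr)
      assume "\<not> k < k2"
      then have "up k m'" using less.prems k2 wide_gap gk
        by (intro up_mono[of k2 k]) auto
      then show False using nup by simp
    qed
    then have "P j (Suc m') \<le> P j m1 + 3 * \<eta> * real (j - k2)"
      using less.prems k2 m' by (intro less.hyps) auto
    moreover have "P j (Suc m2) \<le> P j (Suc m') + 3 * \<eta>"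
      using st[of j "Suc m2"] less.prems \<open>m' < m2\<close> by auto
    moreover have "3 * \<eta> * real (j - k2) + 3 * \<eta> = 3 * \<eta> * real (Suc (j - k2))"
      by (simp add: algebra_simps)
    moreover have "3 * \<eta> * real (Suc (j - k2)) \<le> 3 * \<eta> * real (j - k)"
      using eta_pos \<open>k < k2\<close> k2 by (intro mult_left_mono) auto
    ultimately show ?thesis by linarith
  qed
qed

lemma growth_while_above:
  assumes "j \<in> {1..n}" "m1 \<le> m2" "\<forall>m\<in>{m1..<m2}. above j m"
  shows "P j m2 \<le> P j m1 + 3 * real n * \<eta>"
proof (cases "m1 = m2")
  case True
  then show ?thesis using eta_pos by simp
next
  case False
  then obtain m where m: "m2 = Suc m" "m1 \<le> m" using assms(2) by (cases m2) auto
  then have "above j m" using assms by auto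
  then obtain k where k: "1 \<le> k" "k < j" "wide k m" "up k m"
    by (auto simp: above_def)
  then have "P j m2 \<le> P j m1 + 3 * \<eta> * real (j - k)"
    unfolding m(1) using assms m by (intro growth_above_witness) auto
  also have "\<dots> \<le> P j m1 + 3 * \<eta> * real n"
    using assms eta_pos by (intro add_left_mono mult_left_mono) auto
  finally show ?thesis by (simp add: mult_ac)
qed

text \<open>In one step the gap under j loses at most \<eta>, so it keeps its \<open>up\<close>,
  which \<open>up_mono\<close> carries to every wide gap over j. Consequently a rank that leaves
  \<open>above\<close> first becomes active.\<close>

lemma not_above_then_below:
  assumes "j \<in> {1..n}" "above j m" shows "\<not> below j (Suc m)"
proof
  assume "below j (Suc m)"
  then obtain i where i: "j \<le> i" "i < n" "wide i (Suc m)" "\<not> up i (Suc m)" by (auto simp: below_def)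
  obtain k where k: "1 \<le> k" "k < j" "wide k m" "up k m" using assms by (auto simp: above_def)
  have "P (Suc k) m \<le> P (Suc k) (Suc m)" "P k (Suc m) \<le> P k m + \<eta>"
    using k assms by (auto intro!: P_Suc P_lipschitz)
  then have g: "\<eta> < rank_gap P k (Suc m)" using k(3) eta_pos by (auto simp: wide_def rank_gap_def)
  then have "up k (Suc m)" using k i wide_gap by (intro up_Suc) auto
  then have "up i (Suc m)" using k i wide_gap g by (intro up_mono[of k i]) auto
  then show False using i by simp
qed

text \<open>An inactive period is a stretch of \<open>below\<close> followed by a stretch of
  \<open>above\<close>, each contributing at most 3 n \<eta>.\<close>

lemma growth_while_inactive:
  assumes j: "j \<in> {1..n}" and m: "m1 \<le> m2" and ina: "\<forall>m\<in>{m1..<m2}. \<not> active j m"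
  shows "P j m2 \<le> P j m1 + 6 * real n * \<eta>"
proof -
  \<comment> \<open>The end of the \<open>below\<close> stretch; the alternative
    \<open>m = m2\<close> covers the case that no \<open>above\<close> stretch follows.\<close>
  define m' where "m' = (LEAST m. m1 \<le> m \<and> (m = m2 \<or> above j m))"
  have m': "m1 \<le> m'" "m' = m2 \<or> above j m'"
    using m LeastI[of "\<lambda>m. m1 \<le> m \<and> (m = m2 \<or> above j m)" m2] by (auto simp: m'_def)
  have le: "m' \<le> m2" unfolding m'_def using m by (intro Least_le) auto
  have "below j i" if "i \<in> {m1..<m'}" for i
  proof -
    have "\<not> above j i" using that not_less_Least[of i "\<lambda>m. m1 \<le> m \<and> (m = m2 \<or> above j m)"]
      by (auto simp: m'_def[symmetric])
    then show ?thesis using ina that le by (auto simp: active_def)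
  qed
  then have 1: "P j m' \<le> P j m1 + 3 * real n * \<eta>" using m' j by (intro growth_while_below) auto
  have "i < m2 \<Longrightarrow> above j i" if "m' \<le> i" for i
    using that
  proof (induction i rule: dec_induct)
    case base
    then show ?case using m' by auto
  next
    case (step i)
    then have "above j i" by simp
    then have "\<not> below j (Suc i)" using not_above_then_below j by blast
    then show ?case using ina step m' by (auto simp: active_def)
  qed
  then have "P j m2 \<le> P j m' + 3 * real n * \<eta>" using le j by (intro growth_while_above) auto
  then show ?thesis using 1 by linarith
qed

text \<open>Only the last active time matters: there \<open>P j\<close> is at most \<open>y\<close>,
  and one step plus the inactive drift, 7 n \<eta> in all, stays below 1. The term
  \<open>P j 0\<close> serves a rank that has not yet been active.\<close>

lemma lag_bound:
  assumes j: "j \<in> {1..n}" and y: "0 \<le> y" and act: "\<And>m'. m' < m \<Longrightarrow> active j m' \<Longrightarrow> P j m' \<le> y"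
  shows "P j m \<le> y + P j 0 + 1"
proof (cases "\<exists>m'<m. active j m'")
  case False
  then have "P j m \<le> P j 0 + 6 * real n * \<eta>" by (intro growth_while_inactive[OF j]) auto
  moreover have "6 * real n * \<eta> \<le> 8 * real n * \<eta>" using eta_pos by (intro mult_right_mono) auto
  ultimately show ?thesis using eta_small y by linarith
next
  case True
  define c where "c = (GREATEST m'. m' < m \<and> active j m')"
  have c: "c < m" "active j c"
    using True GreatestI_ex_nat[of "\<lambda>m'. m' < m \<and> active j m'" m] by (auto simp: c_def)
  have "\<not> active j i" if "i \<in> {Suc c..<m}" for i
    using that Greatest_le_nat[of "\<lambda>m'. m' < m \<and> active j m'" i m] by (auto simp: c_def[symmetric])
  then have "P j m \<le> P j (Suc c) + 6 * real n * \<eta>" using c by (intro growth_while_inactive[OF j]) auto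
  moreover have "P j (Suc c) \<le> P j c + \<eta>" using P_lipschitz[OF j] .
  moreover have "P j c \<le> y" using act c by blast
  moreover have "1 * \<eta> \<le> real n * \<eta>" using eta_pos n_pos by (intro mult_right_mono) auto
  moreover have "6 * real n * \<eta> + real n * \<eta> \<le> 8 * real n * \<eta>" using eta_pos by simp
  ultimately show ?thesis using eta_small P_nonneg[OF j, of 0] by linarith
qed


section \<open>Greedy choice of the grid points\<close>

text \<open>
  A state consists of a time \<open>m\<close>, the grid points \<open>Y\<close> and the rank \<open>l\<close> at which the last particle
  landed. A static particle loses \<open>5 \<eta>\<close> in the upper bound for \<open>Y\<close> each time it is overtaken, which
  decreases its rank, so at most \<open>n\<close> times.
\<close>
definition admissible :: "nat \<Rightarrow> (nat \<Rightarrow> nat) \<Rightarrow> nat \<Rightarrow> bool" where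
  "admissible m Y l \<longleftrightarrow> l \<in> {1..n} \<and> 1 \<le> Y 1 \<and>
     (\<forall>i\<in>{1..n}. \<forall>j\<in>{1..n}. i < j \<longrightarrow> Y i < Y j) \<and>
     (\<forall>j\<in>{1..n}. real (Y j) \<le> P j m + real n + 5 * \<eta> * real (n - j)) \<and>
     (\<forall>j. l \<le> j \<longrightarrow> j < n \<longrightarrow> wide j m \<longrightarrow> up j m) \<and>
     (\<forall>m'<m. \<forall>j\<in>{1..n}. active j m' \<longrightarrow> P j m' \<le> real (Y j))"

text \<open>The particle of rank k leaves, those of ranks k + 1 to l drop by one rank, and it lands
  at rank l strictly higher than the former occupant. This is condition (C3) in terms of
  ranks.\<close>

definition jump :: "(nat \<Rightarrow> nat) \<Rightarrow> nat \<Rightarrow> nat \<Rightarrow> (nat \<Rightarrow> nat) \<Rightarrow> bool" where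
  "jump Y k l Y' \<longleftrightarrow> (\<forall>j\<in>{1..n}. j < k \<or> l < j \<longrightarrow> Y' j = Y j) \<and>
     (\<forall>j. k \<le> j \<longrightarrow> j < l \<longrightarrow> Y' j = Y (Suc j)) \<and> Y l < Y' l"

text \<open>Wait until an active rank \<open>j0\<close> has caught up with its grid point, then move
  a particle to the first vacancy over \<open>Y j0\<close>. Ranks that have not caught up are
  controlled by \<open>lag_bound\<close>.\<close>

lemma jump_exists:
  assumes adm: "admissible m Y l"
  shows "\<exists>m' Y' l' k. m \<le> m' \<and> admissible m' Y' l' \<and> 1 \<le> k \<and> k \<le> l \<and> k \<le> l' \<and> jump Y k l' Y' \<and>
     (\<forall>j\<in>{1..n}. P j m' \<le> real (Y j) + P j 0 + 1)"
proof -
  have l: "l \<in> {1..n}" and Y1: "1 \<le> Y 1"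
    and Y_less: "\<And>i j. i \<in> {1..n} \<Longrightarrow> j \<in> {1..n} \<Longrightarrow> i < j \<Longrightarrow> Y i < Y j"
    and Y_upper: "\<And>j. j \<in> {1..n} \<Longrightarrow> real (Y j) \<le> P j m + real n + 5 * \<eta> * real (n - j)"
    and safe: "\<And>j. l \<le> j \<Longrightarrow> j < n \<Longrightarrow> wide j m \<Longrightarrow> up j m"
    and past: "\<And>m' j. m' < m \<Longrightarrow> j \<in> {1..n} \<Longrightarrow> active j m' \<Longrightarrow> P j m' \<le> real (Y j)"
    using adm unfolding admissible_def by auto
  define T where "T m' \<longleftrightarrow> m \<le> m' \<and> (\<exists>j\<in>{1..n}. active j m' \<and> real (Y j) \<le> P j m')" for m'
  have lag: "P j M \<le> real (Y j) + P j 0 + 1" if "\<And>m'. m' < M \<Longrightarrow> \<not> T m'" "j \<in> {1..n}" for j M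
  proof (rule lag_bound)
    fix m' assume "m' < M" "active j m'"
    then show "P j m' \<le> real (Y j)" using that past[of m' j] unfolding T_def by (meson linorder_not_le less_imp_le)
  qed (use that in auto)
  \<comment> \<open>If no active rank ever caught up, all minima would stay bounded.\<close>
  have "\<exists>m'. T m'"
  proof (rule ccontr)
    assume "\<nexists>m'. T m'"
    then have "(\<Sum>j=1..n. P j M) \<le> (\<Sum>j=1..n. real (Y j) + P j 0 + 1)" for M
      using lag by (intro sum_mono) auto
    then show False using P_unbounded[of "\<Sum>j=1..n. real (Y j) + P j 0 + 1"] by (meson not_le)
  qed
  define m' where "m' = (LEAST m'. T m')"
  have T: "T m'" unfolding m'_def using \<open>\<exists>m'. T m'\<close> by (rule LeastI_ex)
  have notT: "\<not> T i" if "i < m'" for i using that not_less_Least unfolding m'_def by blast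
  have mm': "m \<le> m'" using T by (simp add: T_def)
  obtain j0 where j0: "j0 \<in> {1..n}" "active j0 m'" "real (Y j0) \<le> P j0 m'" using T by (auto simp: T_def)
  \<comment> \<open>If \<open>j0 < l\<close>, the particle at \<open>j0\<close> moves; otherwise the
    one that landed last continues. Either way \<open>k \<le> l\<close>, as a canvas
    demands.\<close>
  define k where "k = min l j0"
  \<comment> \<open>The end of the block of consecutive grid points starting at \<open>j0\<close>,
    so that the place right after \<open>Y l'\<close> is free.\<close>
  define l' where "l' = (LEAST i. j0 \<le> i \<and> (i = n \<or> Y (Suc i) \<noteq> Suc (Y i)))"
  have l'1: "j0 \<le> l'" "l' = n \<or> Y (Suc l') \<noteq> Suc (Y l')"
    using LeastI[of "\<lambda>i. j0 \<le> i \<and> (i = n \<or> Y (Suc i) \<noteq> Suc (Y i))" n] j0 by (auto simp: l'_def)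
  have l'n: "l' \<le> n" unfolding l'_def using j0 by (intro Least_le) auto
  have consec: "Y (Suc i) = Suc (Y i)" if "j0 \<le> i" "i < l'" for i
    using that not_less_Least[of i "\<lambda>i. j0 \<le> i \<and> (i = n \<or> Y (Suc i) \<noteq> Suc (Y i))"]
    by (auto simp: l'_def[symmetric])
  have Yl': "Y i = Y j0 + (i - j0)" if "j0 \<le> i" "i \<le> l'" for i
    using that
  proof (induction i rule: dec_induct)
    case (step i)
    then show ?case using consec[of i] by auto
  qed simp
  define Y' where "Y' j = (if j < k \<or> l' < j then Y j else if j = l' then Suc (Y l') else Y (Suc j))" for j
  have k: "1 \<le> k" "k \<le> l" "k \<le> j0" "k \<le> l'" using l j0 l'1 by (auto simp: k_def)
  have Y_le: "Y i \<le> Y j" if "i \<in> {1..n}" "j \<in> {1..n}" "i \<le> j" for i j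
    using Y_less[of i j] that by (cases "i = j") auto
  have YY': "Y j \<le> Y' j" if "j \<in> {1..n}" for j
    using that l'n Y_le[of j "Suc j"] by (auto simp: Y'_def)
  have Y'_step: "Y' j < Y' (Suc j)" if "j \<in> {1..n}" "Suc j \<in> {1..n}" for j
  proof -
    consider "Suc j < k \<or> l' < j" | "Suc j = k" | "k \<le> j" "Suc j < l'" | "k \<le> j" "Suc j = l'" | "k \<le> j" "j = l'"
      by linarith
    then show ?thesis
    proof cases
      case 1
      then show ?thesis using Y_less[of j "Suc j"] that by (auto simp: Y'_def)
    next
      case 2
      then show ?thesis using Y_less[of j "Suc j"] YY'[of "Suc j"] that by (auto simp: Y'_def)
    next
      case 3
      then show ?thesis using Y_less[of "Suc j" "Suc (Suc j)"] that l'n by (auto simp: Y'_def)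
    next
      case 4
      then show ?thesis by (auto simp: Y'_def)
    next
      case 5
      then show ?thesis using Y_less[of l' "Suc l'"] that l'1 by (auto simp: Y'_def)
    qed
  qed
  have Y'_less: "Y' i < Y' j" if "i \<in> {1..n}" "j \<in> {1..n}" "i < j" for i j
  proof -
    have "Suc i \<le> j" using that by simp
    then show ?thesis using that(2)
    proof (induction j rule: dec_induct)
      case base
      then show ?case using Y'_step that by auto
    next
      case (step j)
      then show ?case using Y'_step[of j] that by force
    qed
  qed
  have landing: "real (Suc (Y l')) \<le> P j0 m' + real n"
  proof -
    have "Suc (Y l') \<le> Y j0 + n" using Yl'[of l'] l'1 l'n j0 by auto
    then show ?thesis using j0(3) by linarith
  qed
  txt \<open>The particle that landed at rank \<open>l\<close> may go on up to rank \<open>j0\<close>.\<close>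
  have legit: "P (Suc j) m \<le> P j m' + 5 * \<eta>" if "l \<le> j" "j < j0" for j
  proof -
    have jn: "j \<in> {1..n}" "Suc j \<in> {1..n}" using that l j0 by auto
    have mono: "P (Suc j) m \<le> P (Suc j) m''" "P j m'' \<le> P j m'" if "m \<le> m''" "m'' \<le> m'" for m''
      using that jn by (auto intro: P_mono)
    show ?thesis
    proof (cases "\<exists>m''\<in>{m..m'}. rank_gap P j m'' \<le> 5 * \<eta>")
      case True
      then obtain m'' where "m'' \<in> {m..m'}" "rank_gap P j m'' \<le> 5 * \<eta>" by blast
      then show ?thesis using mono[of m''] by (auto simp: rank_gap_def)
    next
      case False
      \<comment> \<open>When the gap at \<open>j\<close> never closes, \<open>safe\<close> and
        \<open>up_Suc\<close> carry \<open>up j\<close> from \<open>m\<close> to \<open>m'\<close>.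
        Then \<open>j0\<close> would be \<open>above\<close>, hence not active.\<close>
      then have wide: "wide j m''" if "m \<le> m''" "m'' \<le> m'" for m''
        using that unfolding wide_def by (meson atLeastAtMost_iff not_le)
      have "up j m'' " if "m \<le> m''" "m'' \<le> m'" for m''
        using that
      proof (induction m'' rule: dec_induct)
        case base
        then show ?case using safe wide mm' \<open>l \<le> j\<close> jn by auto
      next
        case (step i)
        then show ?case using wide wide_gap jn by (intro up_Suc[of j i]) auto
      qed
      then have "above j0 m'" using wide mm' jn that by (auto simp: above_def intro!: exI[of _ j])
      then show ?thesis using j0 by (simp add: active_def)
    qed
  qed
  have upper': "real (Y' j) \<le> P j m' + real n + 5 * \<eta> * real (n - j)" if j: "j \<in> {1..n}" for j
  proof -
    have e0: "0 \<le> 5 * \<eta> * real (n - j)" using eta_pos by simp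
    consider "j < k \<or> l' < j" | "k \<le> j" "j < j0" | "j0 \<le> j" "j \<le> l'" using k by linarith
    then show ?thesis
    proof cases
      case 1
      then show ?thesis using Y_upper[OF j] P_mono[OF j mm'] by (auto simp: Y'_def)
    next
      case 2
      then have "l \<le> j" "Suc j \<in> {1..n}" using j0 by (auto simp: k_def)
      moreover have "Y' j = Y (Suc j)" using 2 l'1 by (auto simp: Y'_def)
      \<comment> \<open>A particle overtaken by the moving one drops from rank j + 1 to j: this
        releases one more 5 \<eta> on the right, exactly the loss in \<open>legit\<close>.\<close>
      moreover have "5 * \<eta> + 5 * \<eta> * real (n - Suc j) = 5 * \<eta> * real (Suc (n - Suc j))"
        by (simp add: algebra_simps)
      moreover have "Suc (n - Suc j) = n - j" using \<open>Suc j \<in> {1..n}\<close> by simp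
      ultimately show ?thesis using Y_upper[of "Suc j"] legit[of j] 2 by simp
    next
      case 3
      then have "Y' j \<le> Suc (Y l')" using Y_le[of "Suc j" l'] l'n j by (auto simp: Y'_def k_def)
      then have "real (Y' j) \<le> real (Suc (Y l'))" by (rule of_nat_mono)
      also have "\<dots> \<le> P j m' + real n" using landing P_sorted[of j0 j m'] 3 j j0 by linarith
      finally show ?thesis using e0 by linarith
    qed
  qed
  \<comment> \<open>As \<open>j0\<close> is not \<open>below\<close>, every wide gap at or over
    \<open>j0\<close> is \<open>up\<close>.\<close>
  have safe': "up j m'" if "l' \<le> j" "j < n" "wide j m'" for j
    using that l'1 j0(2) by (auto simp: active_def below_def)
  have past': "P j i \<le> real (Y' j)" if "i < m'" "j \<in> {1..n}" "active j i" for i j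
  proof -
    have "P j i \<le> real (Y j)"
    proof (cases "i < m")
      case False
      then show ?thesis using notT[OF that(1)] that unfolding T_def by (meson linorder_not_le less_imp_le)
    qed (use past that in auto)
    then show ?thesis using YY'[OF that(2)] by linarith
  qed
  have "1 \<le> Y' 1" using YY'[of 1] Y1 n_pos by auto
  then have "admissible m' Y' l'"
    unfolding admissible_def using l'1 l'n j0 Y'_less upper' safe' past' by auto
  moreover have "jump Y k l' Y'" unfolding jump_def using k(4) by (auto simp: Y'_def)
  moreover have "\<forall>j\<in>{1..n}. P j m' \<le> real (Y j) + P j 0 + 1" using lag[OF notT] by blast
  ultimately show ?thesis using mm' k by blast
qed

text \<open>These are the positions 1, ..., n, whose sum times the mesh is q_0. Starting with rank n
  makes the condition on gaps at ranks from l up to n - 1 empty.\<close>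

lemma admissible_initial: "admissible 0 (\<lambda>j. j) n"
proof -
  have "real j \<le> P j 0 + real n + 5 * \<eta> * real (n - j)" if "j \<in> {1..n}" for j
    using that P_nonneg[OF that, of 0] eta_pos by (simp add: add_increasing add_increasing2)
  then show ?thesis using n_pos by (auto simp: admissible_def)
qed

text \<open>The points before the jump, \<open>Y i\<close>, and after it, \<open>Y (Suc i)\<close>,
  are compared with the minima at the same time \<open>M (Suc i)\<close>: from above by the last
  clause, from below by admissibility.\<close>

definition trajectory ::
    "(nat \<Rightarrow> nat) \<Rightarrow> (nat \<Rightarrow> nat \<Rightarrow> nat) \<Rightarrow> (nat \<Rightarrow> nat) \<Rightarrow> (nat \<Rightarrow> nat) \<Rightarrow> bool" where
  "trajectory M Y l k \<longleftrightarrow> Y 0 = (\<lambda>j. j) \<and> l 0 = n \<and> (\<forall>i. admissible (M i) (Y i) (l i)) \<and>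
     (\<forall>i. 1 \<le> k i \<and> k i \<le> l i \<and> k i \<le> l (Suc i) \<and> jump (Y i) (k i) (l (Suc i)) (Y (Suc i))) \<and>
     (\<forall>i. \<forall>j\<in>{1..n}. P j (M (Suc i)) \<le> real (Y i j) + P j 0 + 1)"

lemma trajectoryD:
  assumes "trajectory M Y l k"
  shows "Y 0 = (\<lambda>j. j)" "l 0 = n" "admissible (M i) (Y i) (l i)"
    "1 \<le> k i \<and> k i \<le> l i \<and> k i \<le> l (Suc i) \<and> jump (Y i) (k i) (l (Suc i)) (Y (Suc i))"
    "j \<in> {1..n} \<Longrightarrow> P j (M (Suc i)) \<le> real (Y i j) + P j 0 + 1"
  using assms unfolding trajectory_def by auto

lemma trajectory_exists: "\<exists>M Y l k. trajectory M Y l k"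
proof -
  define A where "A i s = (case s of (m, Y, l) \<Rightarrow> admissible m Y l \<and> (i = 0 \<longrightarrow> Y = (\<lambda>j. j) \<and> l = n))"
    for i :: nat and s :: "nat \<times> (nat \<Rightarrow> nat) \<times> nat"
  define S where "S i s s' = (case s of (m, Y, l) \<Rightarrow> case s' of (m', Y', l') \<Rightarrow>
      \<exists>k. 1 \<le> k \<and> k \<le> l \<and> k \<le> l' \<and> jump Y k l' Y' \<and>
      (\<forall>j\<in>{1..n}. P j m' \<le> real (Y j) + P j 0 + 1))" for i :: nat and s s' :: "nat \<times> (nat \<Rightarrow> nat) \<times> nat"
  have "\<exists>f. \<forall>i. A i (f i) \<and> S i (f i) (f (Suc i))"
  proof (rule dependent_nat_choice)
    show "\<exists>s. A 0 s" by (rule exI[of _ "(0, (\<lambda>j. j), n)"]) (simp add: A_def admissible_initial)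
    fix s i assume "A i s"
    then show "\<exists>s'. A (Suc i) s' \<and> S i s s'"
      using jump_exists[of "fst s" "fst (snd s)" "snd (snd s)"]
      by (auto simp: A_def S_def split: prod.splits)
  qed
  then obtain f where f: "\<And>i. A i (f i)" "\<And>i. S i (f i) (f (Suc i))" by blast
  define M Y l where "M i = fst (f i)" and "Y i = fst (snd (f i))" and "l i = snd (snd (f i))" for i
  have fi: "f i = (M i, Y i, l i)" for i by (simp add: M_def Y_def l_def)
  have "\<exists>k. 1 \<le> k \<and> k \<le> l i \<and> k \<le> l (Suc i) \<and> jump (Y i) k (l (Suc i)) (Y (Suc i))" for i
    using f(2)[of i] unfolding S_def fi by auto
  then obtain k where "\<And>i. 1 \<le> k i \<and> k i \<le> l i \<and> k i \<le> l (Suc i) \<and> jump (Y i) (k i) (l (Suc i)) (Y (Suc i))"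
    by metis
  then have "trajectory M Y l k"
    using f[unfolded A_def S_def fi] by (auto simp: trajectory_def)
  then show ?thesis by blast
qed

end

section \<open>Canvases in which a particle may resume its motion\<close>

lemma sort_delete_coord:
  fixes x :: "real list"
  assumes "sorted x" "1 \<le> j" "j \<le> length x"
  shows "sort (delete_coord j x @ [coord x j]) = x"
proof (rule properties_for_sort)
  have "x = take (j - 1) x @ x ! (j - 1) # drop (Suc (j - 1)) x"
    using assms by (intro id_take_nth_drop) auto
  then have "mset x = mset (take (j - 1) x @ x ! (j - 1) # drop (Suc (j - 1)) x)" by simp
  also have "\<dots> = mset (delete_coord j x @ [coord x j])"
    using assms by (simp add: delete_coord_def coord_def)
  finally show "mset x = mset (delete_coord j x @ [coord x j])" .
qed (use assms in auto)

lemma insort_mono: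
  fixes x y :: "'a :: linorder"
  shows "sorted D \<Longrightarrow> x \<le> y \<Longrightarrow> list_all2 (\<le>) (insort x D) (insort y D)"
proof (induction D arbitrary: x)
  case (Cons d D)
  then have "insort d D = d # D" by (intro insort_is_Cons) auto
  then show ?case using Cons Cons.IH[of d] by (auto simp: list_all2_refl)
qed simp

lemma sort_append_single: "sort (D @ [x]) = insort x (sort D)"
  by (metis (no_types) mset_append add.commute append_Cons append_Nil sort_key_simps(2) properties_for_sort sorted_sort mset_sort)

lemma coord_sort_mono:
  fixes D :: "real list"
  assumes "x \<le> y" "j \<in> {1..Suc (length D)}"
  shows "coord (sort (D @ [x])) j \<le> coord (sort (D @ [y])) j"
  using insort_mono[OF sorted_sort assms(1), of D] assms(2)
  by (auto simp: sort_append_single coord_def list_all2_conv_all_nth)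

text \<open>An infinite canvas in which \<open>k i = l i\<close> is tolerated at every index.
  Equality means that the particle which has just landed is the next to move.\<close>

locale precanvas =
  fixes n :: nat and \<delta> :: real and a :: "nat \<Rightarrow> real list" and k l :: "nat \<Rightarrow> nat"
  assumes \<delta>: "0 < \<delta>"
    and len: "length (a i) = n" and srt: "sorted_wrt (<) (a i)"
    and grid: "x \<in> set (a i) \<Longrightarrow> \<exists>m::nat. 1 \<le> m \<and> x = real m * \<delta>"
    and k1: "1 \<le> k i" and kl: "k i \<le> l i" and kl': "k i \<le> l (Suc i)"
    and ln: "l i \<le> n" and l0: "l 0 = n"
    and coords_mono: "j \<in> {1..n} \<Longrightarrow> coord (a i) j \<le> coord (a (Suc i)) j"
    and landing: "coord (a i) (l (Suc i)) + \<delta> \<le> coord (a (Suc i)) (l (Suc i))"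
    and same: "delete_coord (k i) (a i) = delete_coord (l (Suc i)) (a (Suc i))"
begin

definition flat :: "nat \<Rightarrow> real list" where
  "flat i = delete_coord (k i) (a i)"

lemma kn: "k i \<le> n" using kl ln order_trans by blast
lemma l1: "1 \<le> l i" using k1 kl order_trans by blast

lemma switch_eq: "switch_number a i = sum_list (flat i) + coord (a i) (k i)"
  unfolding flat_def using sum_list_delete_coord k1 kn len by metis

lemma switch_Suc_eq: "switch_number a (Suc i) = sum_list (flat i) + coord (a (Suc i)) (l (Suc i))"
  unfolding flat_def same using sum_list_delete_coord l1 ln len by metis

lemma mover_le_landing: "coord (a i) (k i) + \<delta> \<le> coord (a (Suc i)) (l (Suc i))"
proof -
  have "coord (a i) (k i) \<le> coord (a i) (l (Suc i))"
    unfolding coord_def using strict_sorted_imp_sorted[OF srt] kl' l1 ln len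
    by (intro sorted_nth_mono) (auto simp: Suc_le_eq diff_less_Suc less_imp_diff_less diff_le_mono intro: less_le_trans)
  then show ?thesis using landing[of i] by linarith
qed

lemma switch_step: "switch_number a i + \<delta> \<le> switch_number a (Suc i)"
  using mover_le_landing[of i] switch_eq[of i] switch_Suc_eq[of i] by linarith

lemma switch_mono: "i \<le> j \<Longrightarrow> switch_number a i \<le> switch_number a j"
proof (rule lift_Suc_mono_le)
  show "switch_number a i \<le> switch_number a (Suc i)" for i using switch_step[of i] \<delta> by linarith
qed

lemma switch_unbounded: "\<exists>i. q < switch_number a i"
proof -
  have "switch_number a 0 + real i * \<delta> \<le> switch_number a i" for i
  proof (induction i)
    case (Suc i)
    then show ?case using switch_step[of i] by (simp add: algebra_simps)
  qed simp
  moreover obtain i where "q - switch_number a 0 < real i * \<delta>" using reals_Archimedean3[OF \<delta>] by blast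
  ultimately show ?thesis by (intro exI[of _ i]) (smt (verit))
qed

definition step :: "real \<Rightarrow> nat" where
  "step q = (LEAST i. q < switch_number a (Suc i))"

lemma step_less: "q < switch_number a (Suc (step q))"
proof -
  obtain i where "q < switch_number a i" using switch_unbounded by blast
  then have "q < switch_number a (Suc i)" using switch_mono[of i "Suc i"] by simp
  then show ?thesis unfolding step_def by (rule LeastI)
qed

lemma step_le: "switch_number a 0 \<le> q \<Longrightarrow> switch_number a (step q) \<le> q"
proof (cases "step q")
  case (Suc i)
  then have "\<not> q < switch_number a (Suc i)"
    unfolding step_def by (intro not_less_Least) simp
  then show ?thesis using Suc by simp
qed simp

lemma step_ge: "switch_number a i \<le> q \<Longrightarrow> i \<le> step q"
  using step_less[of q] switch_mono[of "Suc (step q)" i] by (metis not_less_eq_eq not_le order_trans)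

lemma step_lt: "switch_number a 0 \<le> q \<Longrightarrow> q < switch_number a i \<Longrightarrow> step q < i"
  using step_le[of q] switch_mono[of i "step q"] by (metis not_le order_trans)

text \<open>The moving coordinate is written as \<open>q\<close> minus the sum of the coordinates at
  rest. It does not refer to the point where the motion began, so a resumed motion is described by
  the same formula.\<close>

definition system :: "real \<Rightarrow> real list" where
  "system q = sort (flat (step q) @ [q - sum_list (flat (step q))])"

text \<open>\<open>a i\<close>, \<open>system q\<close> and \<open>a (Suc i)\<close> arise by
  sorting the same n - 1 resting coordinates with one more entry, and that entry increases along the
  three.\<close>

lemma system_bounds:
  assumes q: "switch_number a 0 \<le> q" and j: "j \<in> {1..n}"
  shows "coord (a (step q)) j \<le> coord (system q) j"
    and "coord (system q) j \<le> coord (a (Suc (step q))) j"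
    and "length (system q) = n" "sum_list (system q) = q"
proof -
  let ?i = "step q"
  have lf: "length (flat ?i) = n - 1"
    using kn[of ?i] k1[of ?i] by (simp add: flat_def delete_coord_def len)
  have n: "Suc (length (flat ?i)) = n" using lf j by auto
  have "a ?i = sort (flat ?i @ [coord (a ?i) (k ?i)])"
    unfolding flat_def using sort_delete_coord[of "a ?i" "k ?i"] strict_sorted_imp_sorted[OF srt] k1 kn len by auto
  moreover have "coord (a ?i) (k ?i) \<le> q - sum_list (flat ?i)"
    using step_le[OF q] by (simp add: switch_eq)
  ultimately show "coord (a ?i) j \<le> coord (system q) j"
    unfolding system_def using coord_sort_mono[of _ _ j "flat ?i"] j n by metis
  have "a (Suc ?i) = sort (flat ?i @ [coord (a (Suc ?i)) (l (Suc ?i))])"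
    unfolding flat_def same using sort_delete_coord[of "a (Suc ?i)" "l (Suc ?i)"] strict_sorted_imp_sorted[OF srt] l1 ln len by auto
  moreover have "q - sum_list (flat ?i) \<le> coord (a (Suc ?i)) (l (Suc ?i))"
    using step_less[of q] by (simp add: switch_Suc_eq)
  ultimately show "coord (system q) j \<le> coord (a (Suc ?i)) j"
    unfolding system_def using coord_sort_mono[of _ _ j "flat ?i"] j n by metis
  show "length (system q) = n" using n by (simp add: system_def)
  have "sum_list (system q) = sum_mset (mset (system q))" by (simp add: sum_mset_sum_list)
  also have "\<dots> = sum_list (flat ?i @ [q - sum_list (flat ?i)])"
    by (simp add: system_def sum_mset_sum_list)
  finally show "sum_list (system q) = q" by simp
qed

section \<open>Merging the steps of a particle that resumes its motion\<close>

text \<open>When \<open>k m = l m\<close>, the coordinate removed at the start of step m is the one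
  that had just landed, so the resting coordinates are unchanged. Condition (C3) therefore passes
  from neighbouring indices to the ends of the run.\<close>

lemma run:
  assumes "i < i'" "\<And>m. i < m \<Longrightarrow> m < i' \<Longrightarrow> k m = l m"
  shows "flat i = delete_coord (l i') (a i') \<and> k i \<le> l i' \<and>
    coord (a i) (l i') + \<delta> \<le> coord (a i') (l i')"
proof -
  have "Suc i \<le> i'" using assms(1) by simp
  then show ?thesis using assms(2)
  proof (induction i' rule: dec_induct)
    case base
    then show ?case using same kl' landing by (simp add: flat_def)
  next
    case (step i')
    then have IH: "flat i = delete_coord (l i') (a i')" "k i \<le> l i'" by auto
    have e: "k i' = l i'" using step by auto
    have "coord (a i) j \<le> coord (a i') j" if "j \<in> {1..n}" for j
      using lift_Suc_mono_le[of "\<lambda>i. coord (a i) j" i i'] coords_mono[OF that] step(1) by auto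
    then have "coord (a i) (l (Suc i')) \<le> coord (a i') (l (Suc i'))" using l1 ln by auto
    then show ?case using IH e same[of i'] kl'[of i'] landing[of i'] by simp
  qed
qed

lemma flat_run:
  assumes "i \<le> i'" "\<And>m. i < m \<Longrightarrow> m \<le> i' \<Longrightarrow> k m = l m"
  shows "flat i' = flat i"
proof (cases "i = i'")
  case False
  then show ?thesis using run[of i i'] assms by (auto simp: flat_def)
qed simp

text \<open>A particle that lands and is the next one to move does not really stop. Dropping these
  switch points may leave finitely many of them: the last particle then moves forever.\<close>

theorem rigid_system_system: "rigid_system n \<delta> (switch_number a 0) system"
proof -
  \<comment> \<open>The switch points to be kept. Index 0 is kept in any case, since (C2) allows
    equality there.\<close>
  define I where "I = {i. i = 0 \<or> k i < l i}"
  define s where "s = (if finite I then enat (card I) else \<infinity>)"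
  define e where "e = enumerate I"
  have eI: "e r \<in> I" if "enat r < s" for r
    using that finite_enumerate_in_set[of I r] enumerate_in_set[of I r] by (auto simp: s_def e_def split: if_splits)
  have emono: "e r < e (Suc r)" if "enat (Suc r) < s" for r
    using that enumerate_step[of I r] finite_enumerate_step[of I r] by (auto simp: s_def e_def split: if_splits)
  have e0: "e 0 = 0" by (auto simp: e_def enumerate_0 I_def intro: Least_equality)
  have s1: "1 \<le> s"
  proof -
    have "0 \<in> I" by (simp add: I_def)
    then have "finite I \<Longrightarrow> card I \<noteq> 0" by auto
    then show ?thesis by (cases "finite I") (simp_all add: s_def one_enat_def Suc_le_eq card_gt_0_iff)
  qed
  have lt: "enat r < s" if "enat (Suc r) < s" for r
    using that by (metis Suc_ile_eq less_imp_le)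
  \<comment> \<open>After the last kept index of a finite canvas the upper bound on \<open>m\<close>
    is void, and all later indices lie outside \<open>I\<close>.\<close>
  have gap: "m \<notin> I" if "enat r < s" "e r < m" "enat (Suc r) < s \<longrightarrow> m < e (Suc r)" for r m
  proof
    assume "m \<in> I"
    have "\<exists>r'. enat r' < s \<and> e r' = m"
      using finite_enumerate_Ex[OF _ \<open>m \<in> I\<close>] enumerate_Ex[OF _ \<open>m \<in> I\<close>]
      by (cases "finite I") (auto simp: s_def e_def)
    then obtain r' where r': "enat r' < s" "m = e r'" by blast
    have mono: "e i \<le> e j" if "i \<le> j" "enat j < s" for i j
      using that
    proof (induction j rule: dec_induct)
      case (step j)
      then show ?case using emono[of j] lt[of j] by (auto intro: order_trans)
    qed simp
    have "r < r'" using mono[of r' r] that r' by (metis leD leI)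
    then have "enat (Suc r) < s" "e (Suc r) \<le> e r'"
      using r' mono[of "Suc r" r'] by (auto intro: le_less_trans[of _ "enat r'"])
    then show False using that r' by simp
  qed
  have kleq: "k m = l m" if "m \<notin> I" for m using that kl[of m] by (auto simp: I_def)
  have epos: "0 < e r" if "1 \<le> r" "enat r < s" for r
    using that emono[of "r - 1"] by (cases r) auto
  have "canvas n \<delta> s (a \<circ> e) (k \<circ> e) (l \<circ> e)"
    unfolding canvas_def
  proof (intro conjI allI impI)
    show "0 < \<delta>" by (rule \<delta>)
    show "1 \<le> s" by (rule s1)
    show "length ((a \<circ> e) i) = n" "sorted_wrt (<) ((a \<circ> e) i)" for i using len srt by auto
    show "\<forall>x\<in>set ((a \<circ> e) i). \<exists>m::nat. 1 \<le> m \<and> x = real m * \<delta>" for i using grid by auto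
    show "1 \<le> (k \<circ> e) 0" "(k \<circ> e) 0 \<le> (l \<circ> e) 0" using k1 kl by auto
    show "(l \<circ> e) 0 = n" using l0 e0 by simp
    fix i
    show "1 \<le> (k \<circ> e) i" "(l \<circ> e) i \<le> n" using k1 ln by auto
    show "(k \<circ> e) i < (l \<circ> e) i" if "1 \<le> i \<and> enat i < s"
      using eI[of i] epos[of i] that by (auto simp: I_def)
    assume i: "enat (i + 1) < s"
    have r: "flat (e i) = delete_coord (l (e (Suc i))) (a (e (Suc i))) \<and> k (e i) \<le> l (e (Suc i)) \<and>
      coord (a (e i)) (l (e (Suc i))) + \<delta> \<le> coord (a (e (Suc i))) (l (e (Suc i)))"
      using i emono[of i] gap[of i] lt[of i] by (intro run kleq) auto
    show "(k \<circ> e) i \<le> (l \<circ> e) (i + 1)"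
      "coord ((a \<circ> e) i) ((l \<circ> e) (i + 1)) + \<delta> \<le> coord ((a \<circ> e) (i + 1)) ((l \<circ> e) (i + 1))"
      "delete_coord ((k \<circ> e) i) ((a \<circ> e) i) = delete_coord ((l \<circ> e) (i + 1)) ((a \<circ> e) (i + 1))"
      using r by (auto simp: flat_def)
  qed
  moreover have "system q = sort (delete_coord ((k \<circ> e) r) ((a \<circ> e) r)
      @ [coord ((a \<circ> e) r) ((k \<circ> e) r) + q - switch_number (a \<circ> e) r])"
    if r: "enat r < s" "switch_number (a \<circ> e) r \<le> q" "enat (r + 1) < s \<longrightarrow> q < switch_number (a \<circ> e) (r + 1)" for r q
  proof -
    have q0: "switch_number a 0 \<le> q" using r(2) switch_mono[of 0 "e r"] by simp
    have "e r \<le> step q" using r(2) by (intro step_ge) simp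
    \<comment> \<open>All steps after \<open>e r\<close> up to the one containing \<open>q\<close>
      are resumptions, so they share their resting coordinates.\<close>
    moreover have "m \<notin> I" if "e r < m" "m \<le> step q" for m
      using step_lt[OF q0, of "e (Suc r)"] r that by (intro gap[of r]) auto
    ultimately have "flat (step q) = flat (e r)" using kleq by (intro flat_run) auto
    then show ?thesis by (simp add: system_def switch_eq) (simp add: flat_def)
  qed
  ultimately show ?thesis unfolding rigid_system_def using e0
    by (intro exI[of _ s] exI[of _ "a \<circ> e"] exI[of _ "k \<circ> e"] exI[of _ "l \<circ> e"]) auto
qed

end

section \<open>Approximation of the minima by a rigid system\<close>

lemma nth_delete_coord:
  assumes "1 \<le> j" "j \<le> length x" "p < length x - 1"
  shows "delete_coord j x ! p = (if Suc p < j then x ! p else x ! Suc p)"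
  using assms by (auto simp: delete_coord_def nth_append min_def less_diff_conv)

text \<open>Sampling with time step log n makes one threshold serve two purposes: a gap exceeding
  the time step fixes the minimal space, and a gap of at least log n is what staticity above a steep
  space requires. As n \<ge> 2, \<open>ln 4\<close> is at most two time steps.\<close>

lemma minima_process_log_minimum:
  fixes u :: "real ^ 'n" and \<delta> q0 :: real
  defines "c \<equiv> ln (real CARD('n))"
  assumes n: "2 \<le> CARD('n)" and u: "norm u = 1" and q0: "0 \<le> q0"
    and \<delta>: "8 * real CARD('n) * c \<le> \<delta>"
  shows "minima_process CARD('n) (\<lambda>j m. log_minimum u j (q0 + real m * c) / \<delta>)
    (\<lambda>j m. steep u j (q0 + real m * c)) (c / \<delta>)"
proof -
  let ?n = "CARD('n)"
  define t where "t m = q0 + real m * c" for m :: nat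
  define L where "L j m = log_minimum u j (t m)" for j m
  define P where "P j m = L j m / \<delta>" for j m
  have c0: "0 < c" using n by (simp add: c_def)
  have c2: "ln 4 \<le> 2 * c"
  proof -
    have "ln (2::real) \<le> c" unfolding c_def using n by (subst ln_le_cancel_iff) auto
    moreover have "ln (4::real) = 2 * ln 2" using ln_realpow[of "2::real" 2] by simp
    ultimately show ?thesis by simp
  qed
  have d0: "0 < \<delta>" using \<delta> c0 n by (smt (verit) mult_pos_pos of_nat_0_less_iff zero_less_card_finite)
  have t0: "0 \<le> t m" and tS: "t (Suc m) = t m + c" for m using c0 q0 by (auto simp: t_def algebra_simps)
  have tmono: "m \<le> m' \<Longrightarrow> t m \<le> t m'" for m m' using c0 by (simp add: t_def mult_right_mono)
  have gap: "c / \<delta> < rank_gap P j m \<longleftrightarrow> L j m + c < L (Suc j) m" for j m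
    using d0 by (auto simp: rank_gap_def P_def field_simps)
  have lip: "L j (Suc m) \<le> L j m + c" if "j \<in> {1..?n}" for j m
    using log_minimum_lipschitz[OF u, of "t m" "t (Suc m)" j] that t0 c0 by (auto simp: L_def tS)
  have mono: "L j m \<le> L j (Suc m)" if "j \<in> {1..?n}" for j m
    using log_minimum_mono[OF u, of "t m" "t (Suc m)" j] that t0 c0 by (auto simp: L_def tS)
  have V: "minimal_space u j (t m) = minimal_space u j (t (Suc m))"
    if "1 \<le> j" "j < ?n" "L j m + c < L (Suc j) m" "L j (Suc m) + c < L (Suc j) (Suc m)" for j m
    using that c0 t0 by (intro minimal_space_eq[OF u]) (auto simp: L_def tS)
  have Vs: "minimal_space u j (t m1) = minimal_space u j (t m2)"
    if "1 \<le> j" "j < ?n" "m1 \<le> m2" "\<And>m. m1 \<le> m \<Longrightarrow> m \<le> m2 \<Longrightarrow> L j m + c < L (Suc j) m" for j m1 m2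
    using that(3,4)
  proof (induction m2 rule: dec_induct)
    case (step m)
    then show ?case using V[of j m] that by auto
  qed simp
  have "minima_process ?n P (\<lambda>j m. steep u j (t m)) (c / \<delta>)"
  proof (unfold_locales)
    show "1 \<le> ?n" "0 < c / \<delta>" using n c0 d0 by auto
    show "8 * real ?n * (c / \<delta>) \<le> 1" using \<delta> d0 by (simp add: field_simps)
    show "0 \<le> P j m" if "j \<in> {1..?n}" for j m
      using log_minimum_attained(1)[OF u t0] that d0 by (auto simp: P_def L_def)
    show "P j m \<le> P j (Suc m)" if "j \<in> {1..?n}" for j m
      using mono[OF that] d0 by (simp add: P_def divide_right_mono)
    show "P j (Suc m) \<le> P j m + c / \<delta>" if "j \<in> {1..?n}" for j m
      using lip[OF that] d0 by (simp add: P_def divide_right_mono flip: add_divide_distrib)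
    show "P i m \<le> P j m" if "i \<in> {1..?n}" "j \<in> {1..?n}" "i \<le> j" for i j m
      using log_minimum_mono_index[OF u t0, of i j] that d0 by (simp add: P_def L_def divide_right_mono)
    show "\<exists>m. B < (\<Sum>j=1..?n. P j m)" for B
    proof -
      obtain m where m: "B * \<delta> + 2 * real ?n * c < real m * c" using reals_Archimedean3[OF c0] by blast
      have "t m \<le> (\<Sum>j=1..?n. L j m) + 2 * real ?n * c"
        using sum_log_minimum_lower[OF u t0, of m] n by (simp add: L_def c_def max_def)
      then have "B * \<delta> < (\<Sum>j=1..?n. L j m)" using m q0 by (simp add: t_def)
      then have "B < (\<Sum>j=1..?n. P j m)" using d0 by (simp add: P_def field_simps flip: sum_divide_distrib)
      then show ?thesis by blast
    qed
    show "steep u j (t (Suc m))" if "1 \<le> j" "j < ?n" "c / \<delta> < rank_gap P j m"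
      "c / \<delta> < rank_gap P j (Suc m)" "steep u j (t m)" for j m
      using that V[of j m] tmono[of m "Suc m"] steep_mono[of "t m" "t (Suc m)" u j] unfolding gap by auto
    show "steep u j (t m)" if "1 \<le> i" "i \<le> j" "j < ?n" "steep u i (t m)" for i j m
      using steep_mono_index[OF u t0, of i j m] that by auto
    show "P i m2 \<le> P i m1 + 3 * (c / \<delta>)"
      if ij: "1 \<le> i" "i \<le> j" "j < ?n" "m1 \<le> m2"
        and Q: "\<forall>m\<in>{m1..<m2}. c / \<delta> < rank_gap P j m \<and> \<not> steep u j (t m)" for i j m1 m2
    proof (cases "m1 = m2")
      case True
      then show ?thesis using c0 d0 by simp
    next
      case False
      \<comment> \<open>The hypotheses hold up to \<open>m\<close> only; the last step to
        \<open>m2\<close> is paid by the Lipschitz bound.\<close>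
      then obtain m where m: "m2 = Suc m" "m1 \<le> m" using ij by (cases m2) auto
      have "L i m \<le> L i m1" using m(2) Q unfolding m(1)
      proof (induction m rule: dec_induct)
        case (step m)
        have g: "L j m + c < L (Suc j) m" "L j (Suc m) + c < L (Suc j) (Suc m)" "\<not> steep u j (t (Suc m))"
          using step unfolding gap by auto
        then have Ve: "minimal_space u j (t m) = minimal_space u j (t (Suc m))" using V[of j m] ij by auto
        have "L i (Suc m) \<le> L i m" unfolding L_def
          using ij t0 tmono[of m "Suc m"] by (intro log_minimum_static[OF u _ _ _ _ _ Ve g(3)]) auto
        moreover have "L i m \<le> L i m1" using step by auto
        ultimately show ?case by simp
      qed simp
      then have "L i m2 \<le> L i m1 + 3 * c" using lip[of i m] ij m(1) c0 by auto
      then show ?thesis using d0 by (simp add: P_def field_simps)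
    qed
    show "P i m2 \<le> P i m1 + 3 * (c / \<delta>)"
      if ij: "1 \<le> j" "j < i" "i \<le> ?n" "m1 \<le> m2"
        and Q: "\<forall>m\<in>{m1..<m2}. c / \<delta> < rank_gap P j m \<and> steep u j (t m)" for i j m1 m2
    proof (cases "m1 = m2")
      case True
      then show ?thesis using c0 d0 by simp
    next
      case False
      then obtain m where m: "m2 = Suc m" "m1 \<le> m" using ij by (cases m2) auto
      have g: "L j m' + c < L (Suc j) m'" "steep u j (t m')" if "m1 \<le> m'" "m' \<le> m" for m'
        using Q that unfolding m(1) gap by auto
      have "L i m \<le> L i m1 + ln 4" unfolding L_def
      proof (rule log_minimum_static_above[OF u, of _ _ j])
        show "minimal_space u j (t m1) = minimal_space u j (t m)" using ij m g(1) by (intro Vs) auto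
        show "steep u j (t m1)" using g(2) m by simp
        show "log_minimum u j (t m) + ln (real ?n) \<le> log_minimum u (Suc j) (t m)"
          "log_minimum u j (t m) < log_minimum u (Suc j) (t m)"
          using g(1)[of m] m(2) c0 unfolding L_def c_def[symmetric] by auto
      qed (use ij m t0 tmono[of m1 m] in auto)
      then have "L i m2 \<le> L i m1 + 3 * c" using lip[of i m] ij m(1) c2 by auto
      then show ?thesis using d0 by (simp add: P_def field_simps)
    qed
  qed
  moreover have "P = (\<lambda>j m. log_minimum u j (q0 + real m * c) / \<delta>)"
    by (simp add: fun_eq_iff P_def L_def t_def)
  ultimately show ?thesis by (simp add: t_def)
qed

section \<open>From grid points to the rigid system\<close>

lemma (in minima_process) precanvas_trajectory:
  assumes \<delta>: "0 < \<delta>" and traj: "trajectory M Y l k"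
  shows "precanvas n \<delta> (\<lambda>i. map (\<lambda>j. \<delta> * real (Y i j)) [1..<Suc n]) k l"
    (is "precanvas n \<delta> ?a k l")
proof
  note l0 = trajectoryD(2)[OF traj]
    and adm = trajectoryD(3)[OF traj] and k = trajectoryD(4)[OF traj]
  have l: "1 \<le> l i" "l i \<le> n" and Y1: "1 \<le> Y i 1"
    and Y_less: "\<And>p q. p \<in> {1..n} \<Longrightarrow> q \<in> {1..n} \<Longrightarrow> p < q \<Longrightarrow> Y i p < Y i q" for i
    using adm[of i] by (auto simp: admissible_def)
  have coord: "coord (?a i) j = \<delta> * real (Y i j)" if "j \<in> {1..n}" for i j
    using that nth_upt[of 1 "j - 1" "Suc n"] by (auto simp: coord_def simp del: upt_Suc)
  show "0 < \<delta>" by (rule \<delta>)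
  show "length (?a i) = n" for i by simp
  show "sorted_wrt (<) (?a i)" for i
    using Y_less[of _ _ i] \<delta> by (auto simp: sorted_wrt_iff_nth_less simp del: upt_Suc)
  show "\<exists>m::nat. 1 \<le> m \<and> x = real m * \<delta>" if x: "x \<in> set (?a i)" for x i
  proof -
    obtain j where j: "j \<in> {1..n}" "x = \<delta> * real (Y i j)"
      using x by (auto simp: atLeastLessThanSuc_atLeastAtMost simp del: upt_Suc)
    moreover have "1 \<le> Y i j" using Y1[of i] Y_less[of 1 j i] j by (cases "j = 1") auto
    ultimately show ?thesis by (intro exI[of _ "Y i j"]) simp
  qed
  show "1 \<le> k i" "k i \<le> l i" "k i \<le> l (Suc i)" for i using k by auto
  show "l i \<le> n" "l 0 = n" for i using l l0 by auto
  fix i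
  have jump: "jump (Y i) (k i) (l (Suc i)) (Y (Suc i))" using k by blast
  have le: "Y i j \<le> Y (Suc i) j" if "j \<in> {1..n}" for j
  proof -
    consider "j < k i \<or> l (Suc i) < j" | "k i \<le> j" "j < l (Suc i)" | "j = l (Suc i)" by linarith
    then show ?thesis
      using jump that Y_less[of j "Suc j" i] l(2)[of "Suc i"] unfolding jump_def by cases auto
  qed
  show "coord (?a i) j \<le> coord (?a (Suc i)) j" if "j \<in> {1..n}" for j
    unfolding coord[OF that] using le[OF that] \<delta> by simp
  have "Suc (Y i (l (Suc i))) \<le> Y (Suc i) (l (Suc i))" using jump by (simp add: jump_def)
  then have "\<delta> * real (Suc (Y i (l (Suc i)))) \<le> \<delta> * real (Y (Suc i) (l (Suc i)))"
    using \<delta> by (intro mult_left_mono of_nat_mono) auto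
  then show "coord (?a i) (l (Suc i)) + \<delta> \<le> coord (?a (Suc i)) (l (Suc i))"
    using l[of "Suc i"] by (subst (1 2) coord) (auto simp: algebra_simps)
  show "delete_coord (k i) (?a i) = delete_coord (l (Suc i)) (?a (Suc i))"
  proof (rule nth_equalityI)
    have kn: "1 \<le> k i" "k i \<le> n" using k[of i] l(2)[of i] by auto
    then show "length (delete_coord (k i) (?a i)) = length (delete_coord (l (Suc i)) (?a (Suc i)))"
      using l[of "Suc i"] by (simp add: delete_coord_def)
    fix p assume "p < length (delete_coord (k i) (?a i))"
    then have p: "p < n - 1" using kn by (simp add: delete_coord_def)
    have nth: "?a i' ! p' = \<delta> * real (Y i' (Suc p'))" if "p' < n" for i' p'
      using that by (simp del: upt_Suc)
    have nd: "delete_coord j (?a i') ! p = \<delta> * real (Y i' (if Suc p < j then Suc p else Suc (Suc p)))"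
      if "1 \<le> j" "j \<le> n" for i' j
      using that p nth[of p i'] nth[of "Suc p" i'] by (subst nth_delete_coord) (auto simp del: upt_Suc)
    \<comment> \<open>Position \<open>p\<close> counts from 0 and stands for rank p + 1. It lies
      before both deleted ranks, between them where the particles have dropped by one, or after
      both.\<close>
    consider "Suc p < k i" | "k i \<le> Suc p" "Suc p < l (Suc i)" | "l (Suc i) \<le> Suc p" "k i \<le> Suc p"
      using k[of i] by linarith
    then show "delete_coord (k i) (?a i) ! p = delete_coord (l (Suc i)) (?a (Suc i)) ! p"
      unfolding nd[OF kn] nd[OF l] using jump p k[of i] unfolding jump_def by cases auto
  qed
qed

theorem theorem8p2:
  fixes u :: "real ^ 'n" and \<delta> q0 :: real and n :: nat
  assumes "n = CARD('n)" and "2 \<le> n"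
    and "\<delta> > 24 * real n ^ 4 * 2 ^ n * ln (real n)"
    and "norm u = 1"
    and "q0 = real n * (real n + 1) * \<delta> / 2"
  shows "\<exists>R. rigid_system n \<delta> q0 R \<and>
           (\<forall>q \<ge> q0. sup_norm (map2 (-) (log_minima u q) (R q)) \<le> 4 * real n ^ 2 * \<delta>)"
proof -
  define c where "c = ln (real n)"
  have c0: "0 < c" using assms(2) by (simp add: c_def)
  have "real n \<le> real n ^ 4" using assms(2) self_le_power[of "real n" 4] by simp
  then have "8 * real n * 1 \<le> 24 * real n ^ 4 * 2 ^ n" by (intro mult_mono) auto
  then have "8 * real n * 1 * c \<le> 24 * real n ^ 4 * 2 ^ n * c" using c0 by (intro mult_right_mono) auto
  \<comment> \<open>In this form the mesh yields \<open>eta_small\<close> and absorbs each error of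
    size n log n or 2 n log n in one \<delta>.\<close>
  then have \<delta>: "8 * real n * c \<le> \<delta>" using assms(3) unfolding c_def by linarith
  have nc: "2 * c \<le> real n * c" using assms(2) c0 by (intro mult_right_mono) auto
  then have d0: "0 < \<delta>" using \<delta> c0 by linarith
  have q0: "0 \<le> q0" unfolding assms(5) using d0 by simp
  define t where "t m = q0 + real m * c" for m :: nat
  have t0: "0 \<le> t m" for m using c0 q0 by (simp add: t_def)
  define L where "L j q = log_minimum u j q" for j q
  define P where "P j m = L j (t m) / \<delta>" for j m
  interpret minima_process n P "\<lambda>j m. steep u j (t m)" "c / \<delta>"
    using minima_process_log_minimum[of u q0 \<delta>] assms(1,2,4) q0 \<delta> unfolding P_def L_def t_def c_def by simp
  obtain M Y l k where traj: "trajectory M Y l k" using trajectory_exists by blast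
  note Y = trajectoryD[OF traj]
  define a where "a i = map (\<lambda>j. \<delta> * real (Y i j)) [1..<Suc n]" for i
  interpret C: precanvas n \<delta> a k l
    unfolding a_def by (rule precanvas_trajectory[OF d0 traj])
  have a_coord: "coord (a i) j = \<delta> * real (Y i j)" if "j \<in> {1..n}" for i j
    using that nth_upt[of 1 "j - 1" "Suc n"] by (auto simp: coord_def a_def simp del: upt_Suc)
  have "switch_number a 0 = (\<Sum>j=1..n. \<delta> * real j)"
    by (simp add: a_def Y(1) interv_sum_list_conv_sum_set_nat atLeastLessThanSuc_atLeastAtMost del: upt_Suc)
  also have "\<dots> = q0"
  proof -
    have "2 * (\<Sum>j=1..n. real j) = real n * (real n + 1)"
      using double_gauss_sum_from_Suc_0[of n, where 'a=real] by (simp add: add.commute)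
    then show ?thesis unfolding sum_distrib_left[symmetric] assms(5) by (simp add: algebra_simps)
  qed
  finally have a0: "switch_number a 0 = q0" .
  have "\<bar>L j q - coord (C.system q) j\<bar> \<le> 4 * real n ^ 2 * \<delta>" if q: "q0 \<le> q" and j: "j \<in> {1..n}" for q j
  proof -
    define i where "i = C.step q"
    \<comment> \<open>\<open>q\<close> is the parameter of the system and \<open>s\<close> the time
      at which the minima caused the current jump. The two are related only through the sums of
      coordinates.\<close>
    define s where "s = t (M (Suc i))"
    define R where "R j = coord (C.system q) j" for j
    note sb = C.system_bounds[of q, unfolded a0, OF q]
    have lo: "L j s \<le> R j + L j q0 + \<delta>" if "j \<in> {1..n}" for j
    proof -
      have "L j s \<le> \<delta> * real (Y i j) + L j q0 + \<delta>"
        using Y(5)[OF that, of i] d0 by (simp add: P_def s_def t_def field_simps)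
      also have "\<delta> * real (Y i j) \<le> R j" using sb(1)[OF that] that by (simp add: a_coord R_def i_def)
      finally show ?thesis by simp
    qed
    have hi: "R j \<le> L j s + (real n + 1) * \<delta>" if "j \<in> {1..n}" for j
    proof -
      have "real (Y (Suc i) j) \<le> P j (M (Suc i)) + real n + 5 * (c / \<delta>) * real (n - j)"
        using Y(3)[of "Suc i"] that by (simp add: admissible_def)
      then have "\<delta> * real (Y (Suc i) j) \<le>
          \<delta> * (P j (M (Suc i)) + real n + 5 * (c / \<delta>) * real (n - j))"
        using d0 by (intro mult_left_mono) auto
      also have "\<dots> = L j s + real n * \<delta> + 5 * c * real (n - j)"
        using d0 by (simp add: P_def s_def field_simps)
      finally have "\<delta> * real (Y (Suc i) j) \<le> L j s + real n * \<delta> + 5 * c * real (n - j)" .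
      moreover have "5 * c * real (n - j) \<le> 8 * c * real n" using c0 by (intro mult_mono) auto
      moreover have "R j \<le> \<delta> * real (Y (Suc i) j)" using sb(2)[OF that] that by (simp add: a_coord R_def i_def)
      ultimately show ?thesis using \<delta> by (simp add: algebra_simps)
    qed
    have "sum_list (C.system q) = (\<Sum>j=1..n. R j)"
      unfolding sum_list_sum_nth sb(3)[OF j] R_def coord_def
      by (rule sum.reindex_bij_witness[of _ "\<lambda>j. j - 1" Suc]) auto
    \<comment> \<open>The coordinates of the system add up to \<open>q\<close>, the minima at
      \<open>s\<close> to \<open>s\<close> up to \<delta>. Summing \<open>lo\<close> and
      \<open>hi\<close> therefore bounds \<open>q - s\<close> from both sides.\<close>
    then have sumR: "(\<Sum>j=1..n. R j) = q" using sb(4)[OF j] by simp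
    have sumL: "q' \<le> (\<Sum>j=1..n. L j q') + \<delta>" "(\<Sum>j=1..n. L j q') \<le> q' + \<delta>" if "0 \<le> q'" for q'
      using sum_log_minimum_lower[OF assms(4) that] sum_log_minimum_upper[OF assms(4) that] assms(1,2) \<delta> nc c0
      by (auto simp: L_def c_def max_def)
    have "(\<Sum>j=1..n. L j s) \<le> (\<Sum>j=1..n. R j + L j q0 + \<delta>)" using lo by (intro sum_mono) auto
    then have 1: "s - q \<le> q0 + (real n + 2) * \<delta>"
      using sumR sumL(1)[of s] sumL(2)[OF q0] t0 by (simp add: s_def sum.distrib algebra_simps)
    have "(\<Sum>j=1..n. R j) \<le> (\<Sum>j=1..n. L j s + (real n + 1) * \<delta>)" using hi by (intro sum_mono) auto
    then have 2: "q - s \<le> (real n * (real n + 1) + 1) * \<delta>"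
      using sumR sumL(2)[of s] t0 by (simp add: s_def sum.distrib algebra_simps)
    have Lnn: "0 \<le> L j q'" if "j \<in> {1..n}" "0 \<le> q'" for j q'
      using log_minimum_attained(1)[OF assms(4)] that assms(1) by (simp add: L_def)
    have "L j q0 \<le> (\<Sum>j=1..n. L j q0)" using Lnn q0 j by (intro member_le_sum) auto
    then have Lq0: "L j q0 \<le> q0 + \<delta>" using sumL(2)[OF q0] by simp
    have Lq: "L j q1 \<le> L j q2" "L j q2 \<le> L j q1 + (q2 - q1)" if "0 \<le> q1" "q1 \<le> q2" for q1 q2
      using log_minimum_mono[OF assms(4) that] log_minimum_lipschitz[OF assms(4) that] j assms(1) by (auto simp: L_def)
    have sq: "0 \<le> s" "0 \<le> q" using t0 q q0 by (auto simp: s_def)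
    \<comment> \<open>Names for n^2 \<delta> and n \<delta>, in which all remaining estimates are
      linear.\<close>
    define X Z where "X = real n * real n * \<delta>" and "Z = real n * \<delta>"
    have n2: "2 * real n \<le> real n * real n" "4 \<le> real n * real n"
      using assms(2) mult_mono[of 2 "real n" 2 "real n"] by (auto intro: mult_right_mono)
    have XZ: "2 * Z \<le> X" "4 * \<delta> \<le> X"
      using mult_right_mono[OF n2(1), of \<delta>] mult_right_mono[OF n2(2), of \<delta>] d0 by (auto simp: X_def Z_def)
    have q0e: "q0 = (X + Z) / 2" by (simp add: assms(5) X_def Z_def algebra_simps)
    have 1: "s - q \<le> q0 + Z + 2 * \<delta>" and 2: "q - s \<le> X + Z + \<delta>"
      using 1 2 by (auto simp: X_def Z_def algebra_simps)
    have "0 \<le> Z" using d0 by (simp add: Z_def)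
    then have "L j q \<le> L j s + (X + Z + \<delta>) \<and> L j s \<le> L j q + (q0 + Z + 2 * \<delta>)"
    proof (cases "q \<le> s")
      case True
      then show ?thesis using 1 Lq[OF sq(2) True] XZ d0 \<open>0 \<le> Z\<close> by linarith
    next
      case False
      then have "s \<le> q" by simp
      then show ?thesis using 2 Lq[OF sq(1) \<open>s \<le> q\<close>] q0 d0 \<open>0 \<le> Z\<close> by linarith
    qed
    moreover have "R j \<le> L j s + (Z + \<delta>)" using hi[OF j] by (simp add: Z_def algebra_simps)
    ultimately have est: "L j q \<le> L j s + (X + Z + \<delta>)" "L j s \<le> L j q + (q0 + Z + 2 * \<delta>)"
      "R j \<le> L j s + (Z + \<delta>)" by auto
    \<comment> \<open>The total is at most 3/2 X + 3/2 Z + 3 \<delta>, thus at most 3 X; the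
      opposite difference is at most 1/2 X + 5/2 Z + 3 \<delta>.\<close>
    have "L j q - R j \<le> 4 * X" using est(1) lo[OF j] Lq0 XZ q0e d0 by argo
    moreover have "R j - L j q \<le> 4 * X" using est(2,3) XZ q0e d0 by argo
    ultimately show ?thesis by (simp add: R_def X_def power2_eq_square abs_le_iff)
  qed
  moreover have "sup_norm (map2 (-) (log_minima u q) (C.system q)) \<le> B"
    if q: "q0 \<le> q" and B: "\<And>j. j \<in> {1..n} \<Longrightarrow> \<bar>L j q - coord (C.system q) j\<bar> \<le> B" for q B
  proof -
    have len: "length (C.system q) = n" using C.system_bounds(3)[of q 1] q a0 assms(2) by simp
    have "\<bar>x\<bar> \<le> B" if x: "x \<in> set (map2 (-) (log_minima u q) (C.system q))" for x
    proof -
      obtain p where p: "p < n" "x = log_minima u q ! p - C.system q ! p"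
        using x len assms(1) by (auto simp: in_set_conv_nth log_minima_def simp del: upt_Suc)
      then show ?thesis using B[of "Suc p"] assms(1) by (simp add: log_minima_def L_def coord_def del: upt_Suc)
    qed
    moreover have "map2 (-) (log_minima u q) (C.system q) \<noteq> []"
      using len assms(1,2) by (auto simp: log_minima_def simp del: upt_Suc)
    ultimately show ?thesis unfolding sup_norm_def by (intro Max.boundedI) auto
  qed
  ultimately show ?thesis using C.rigid_system_system a0 by (intro exI[of _ C.system]) auto
qed

end
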